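(* Let $n\ge 1$, let $\mathfrak g$ be a finite-dimensional simple complex Lie algebra with Cartan subalgebra $\mathfrak h$, let $\lambda\in(\mathbb C^* )^n$ and let $M_{\mathfrak g}\in\mathcal M(\mathfrak g,\mathfrak h)$. The $\widetilde{\mathfrak g}_n$-module $\widetilde M_{\widetilde{\mathfrak g}_n}(\lambda,M_{\mathfrak g})$ is simple if and only if the $\mathfrak g$-module $M_{\mathfrak g}$ is simple.
   Context: All vector spaces, algebras and tensor products are over $\mathbb C$. $U(\mathfrak a)$ denotes the universal enveloping algebra of a Lie algebra $\mathfrak a$. Category: for a Lie algebra $\mathfrak a$ and a finite-dimensional abelian subalgebra $\mathfrak b\subseteq\mathfrak a$, $\mathcal M(\mathfrak a,\mathfrak b)$ is the full subcategory of $U(\mathfrak a)$-modules whose restriction to $U(\mathfrak b)$ is free of rank $1$. Each object is identified with the vector space $U(\mathfrak b)$ on which $\mathfrak b$ acts by multiplication, so that $1\in U(\mathfrak b)$ is a free generator. Notation for $\mathfrak g$: $\mathfrak g$ is a finite-dimensional simple Lie algebra of rank $l$ with Cartan subalgebra $\mathfrak h$, Chevalley generators $x_i,y_i,h_i$ ($1\le i\le l$), and $\{H_1,\dots,H_l\}$ is the basis of $\mathfrak h$ with $[H_i,x_j]=\delta_{ij}x_i$, $[H_i,y_j]=-\delta_{ij}y_j$. $(\cdot,\cdot)$ is the Killing form. Toroidal Lie algebra: let $A=\mathbb C[t_1^{\pm1},\dots,t_n^{\pm1}]$, $t^m=t_1^{m_1}\cdots t_n^{m_n}$ for $m\in\mathbb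 Z^n$; $\Omega_A$ is the free $A$-module with basis $K_1,\dots,K_n$; $dA\subseteq\Omega_A$ is the span of the elements $\sum_i m_i t^mK_i$, $m\in\mathbb Z^n$; $\mathcal K_A=\Omega_A/dA$; $D=\bigoplus_{i=1}^n\mathbb C d_i$. Write $x(a)=x\otimes t^a$. Then $\widetilde{\mathfrak g}_n=(\mathfrak g\otimes A)\oplus\mathcal K_A\oplus D$ with brackets $[x(a),y(b)]=[x,y](a+b)+(x,y)\sum_{i=1}^n a_i t^{a+b}K_i$, $[\mathfrak g\otimes A,\mathcal K_A]=[\mathcal K_A,\mathcal K_A]=0$, $[d_i,x(a)]=a_ix(a)$, $[d_i,t^aK_j]=a_it^aK_j$, $[d_i,d_j]=0$. Put $\widetilde{\mathfrak h}_n=\mathfrak h\oplus D$, so $U(\widetilde{\mathfrak h}_n)=\mathbb C[H_1,\dots,H_l,d_1,\dots,d_n]\supset U(\mathfrak h)=\mathbb C[H_1,\dots,H_l]$. Automorphisms of $U(\widetilde{\mathfrak h}_n)$: $\sigma_i$ sends $H_i\mapsto H_i-1$ and fixes all other generators; $\tau_j$ sends $d_j\mapsto d_j-1$ and fixes all other generators. For $a\in\mathbb Z^n$, $\tau^a=\tau_1^{a_1}\cdots\tau_n^{a_n}$ and $\lambda^a=\lambda_1^{a_1}\cdots\lambda_n^{a_n}$. The module $\widetilde M_{\widetilde{\mathfrak g}_n}(\lambda,M_{\mathfrak g})$: for $M_{\mathfrak g}\in\mathcal M(\mathfrak g,\mathfrak h)$ (so $M_{\mathfrak g}=U(\mathfrak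 h)$ as a space) and $\lambda\in(\mathbb C^* )^n$, it is the space $U(\widetilde{\mathfrak h}_n)$ with, for $g\in U(\widetilde{\mathfrak h}_n)$, $a\in\mathbb Z^n$, $h\in\mathfrak h$, $1\le i\le l$, $1\le j\le n$: $t^aK_j.g=0$; $d_j.g=d_jg$; $h(a).g=\lambda^a h\,\tau^a(g)$; $x_i(a).g=\lambda^a\sigma_i\tau^a(g)\,(x_i.1)$; $y_i(a).g=\lambda^a\sigma_i^{-1}\tau^a(g)\,(y_i.1)$, where $x_i.1,y_i.1\in U(\mathfrak h)$ are given by the $\mathfrak g$-module structure of $M_{\mathfrak g}$. This defines a $\widetilde{\mathfrak g}_n$-module. *)

theory Defs
  imports "HOL-Analysis.Analysis" "HOL-Library.Poly_Mapping"
begin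

section \<open>Complex Lie algebras and their modules\<close>

locale lie_algebra = vector_space scaleG
  for scaleG :: "complex \<Rightarrow> 'g::ab_group_add \<Rightarrow> 'g" +
  fixes bracket :: "'g \<Rightarrow> 'g \<Rightarrow> 'g"
  assumes bracket_linear_left: "Vector_Spaces.linear scaleG scaleG (\<lambda>x. bracket x y)"
    and bracket_linear_right: "Vector_Spaces.linear scaleG scaleG (bracket x)"
    and bracket_alternating: "bracket x x = 0"
    and jacobi: "bracket x (bracket y z) + bracket y (bracket z x) + bracket z (bracket x y) = 0"
begin

definition subalgebra :: "'g set \<Rightarrow> bool" where
  "subalgebra S \<longleftrightarrow> subspace S \<and> (\<forall>x\<in>S. \<forall>y\<in>S. bracket x y \<in> S)"

definition ideal :: "'g set \<Rightarrow> bool" where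
  "ideal I \<longleftrightarrow> subspace I \<and> (\<forall>x. \<forall>y\<in>I. bracket x y \<in> I)"

definition generates :: "'g set \<Rightarrow> bool" where
  "generates X \<longleftrightarrow> (\<forall>S. subalgebra S \<and> X \<subseteq> S \<longrightarrow> S = UNIV)"

primrec lower_central :: "'g set \<Rightarrow> nat \<Rightarrow> 'g set" where
  "lower_central S 0 = S"
| "lower_central S (Suc k) = span {bracket x y | x y. x \<in> S \<and> y \<in> lower_central S k}"

text \<open>Nilpotent and self-normalising.\<close>

definition cartan_subalgebra :: "'g set \<Rightarrow> bool" where
  "cartan_subalgebra \<hh> \<longleftrightarrow> subalgebra \<hh> \<and> (\<exists>k. lower_central \<hh> k = {0}) \<and>
     {x. \<forall>y\<in>\<hh>. bracket x y \<in> \<hh>} = \<hh>"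

definition trace_of :: "('g \<Rightarrow> 'g) \<Rightarrow> complex" where
  "trace_of f = (let B = (SOME B. independent B \<and> span B = UNIV)
     in \<Sum>b\<in>B. representation B (f b) b)"

definition killing_form :: "'g \<Rightarrow> 'g \<Rightarrow> complex" where
  "killing_form x y = trace_of (\<lambda>z. bracket x (bracket y z))"

text \<open>The entry \<open>A i j\<close> of the Cartan matrix is the value of the \<open>j\<close>-th simple root on the
  \<open>i\<close>-th coroot. The index type \<open>'i\<close> has as many elements as the rank.\<close>

definition chevalley_generators ::
    "'g set \<Rightarrow> ('i::finite \<Rightarrow> 'g) \<Rightarrow> ('i \<Rightarrow> 'g) \<Rightarrow> ('i \<Rightarrow> 'g) \<Rightarrow> bool" where
  "chevalley_generators \<hh> x y h \<longleftrightarrow>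
     inj h \<and> independent (range h) \<and> span (range h) = \<hh> \<and>
     (\<exists>A :: 'i \<Rightarrow> 'i \<Rightarrow> int.
        (\<forall>i. A i i = 2) \<and>
        (\<forall>i j. i \<noteq> j \<longrightarrow> A i j \<le> 0) \<and>
        (\<forall>i j. bracket (x i) (y j) = (if i = j then h i else 0)) \<and>
        (\<forall>i j. bracket (h i) (x j) = scaleG (of_int (A i j)) (x j)) \<and>
        (\<forall>i j. bracket (h i) (y j) = - scaleG (of_int (A i j)) (y j)) \<and>
        (\<forall>i j. i \<noteq> j \<longrightarrow> (bracket (x i) ^^ nat (1 - A i j)) (x j) = 0) \<and>
        (\<forall>i j. i \<noteq> j \<longrightarrow> (bracket (y i) ^^ nat (1 - A i j)) (y j) = 0)) \<and>
     generates (range x \<union> range y)"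

definition root_dual_basis ::
    "'g set \<Rightarrow> ('i::finite \<Rightarrow> 'g) \<Rightarrow> ('i \<Rightarrow> 'g) \<Rightarrow> ('i \<Rightarrow> 'g) \<Rightarrow> bool" where
  "root_dual_basis \<hh> x y H \<longleftrightarrow>
     inj H \<and> independent (range H) \<and> span (range H) = \<hh> \<and>
     (\<forall>i j. bracket (H i) (x j) = (if i = j then x i else 0)) \<and>
     (\<forall>i j. bracket (H i) (y j) = (if i = j then - y i else 0))"

end

locale simple_lie_algebra = lie_algebra +
  assumes finite_dim: "\<exists>B. finite B \<and> span B = UNIV"
    and non_abelian: "\<exists>x y. bracket x y \<noteq> 0"
    and simple: "ideal I \<Longrightarrow> I = {0} \<or> I = UNIV"

locale lie_module = L: lie_algebra scaleG bracket + V: vector_space scaleV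
  for scaleG :: "complex \<Rightarrow> 'g::ab_group_add \<Rightarrow> 'g"
    and bracket :: "'g \<Rightarrow> 'g \<Rightarrow> 'g"
    and scaleV :: "complex \<Rightarrow> 'v::ab_group_add \<Rightarrow> 'v" +
  fixes act :: "'g \<Rightarrow> 'v \<Rightarrow> 'v"
  assumes act_linear_left: "Vector_Spaces.linear scaleG scaleV (\<lambda>x. act x v)"
    and act_linear_right: "Vector_Spaces.linear scaleV scaleV (act x)"
    and act_bracket: "act (bracket x y) v = act x (act y v) - act y (act x v)"
begin

definition submodule :: "'v set \<Rightarrow> bool" where
  "submodule W \<longleftrightarrow> V.subspace W \<and> (\<forall>x. \<forall>w\<in>W. act x w \<in> W)"

end

locale simple_lie_module = lie_module scaleG bracket scaleV act
  for scaleG :: "complex \<Rightarrow> 'g::ab_group_add \<Rightarrow> 'g"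
    and bracket :: "'g \<Rightarrow> 'g \<Rightarrow> 'g"
    and scaleV :: "complex \<Rightarrow> 'v::ab_group_add \<Rightarrow> 'v"
    and act :: "'g \<Rightarrow> 'v \<Rightarrow> 'v" +
  assumes nonzero: "\<exists>v :: 'v. v \<noteq> 0"
    and simple: "submodule W \<Longrightarrow> W = {0} \<or> W = UNIV"


section \<open>Polynomials and shift automorphisms\<close>

text \<open>The polynomial algebra on variables of type \<open>'v\<close>, as complex-valued functions of finite
  support on the exponent vectors.\<close>

type_synonym 'v mpoly = "('v \<Rightarrow>\<^sub>0 nat) \<Rightarrow>\<^sub>0 complex"

definition Const :: "complex \<Rightarrow> ('a::zero \<Rightarrow>\<^sub>0 complex)" where
  "Const c = Poly_Mapping.single 0 c"

definition Var :: "'v \<Rightarrow> 'v mpoly" where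
  "Var v = Poly_Mapping.single (Poly_Mapping.single v 1) 1"

definition poly_scale :: "complex \<Rightarrow> 'v mpoly \<Rightarrow> 'v mpoly" where
  "poly_scale c p = Const c * p"

definition subst :: "('v \<Rightarrow> 'w mpoly) \<Rightarrow> 'v mpoly \<Rightarrow> 'w mpoly" where
  "subst f p = (\<Sum>m\<in>Poly_Mapping.keys p.
     Const (Poly_Mapping.lookup p m) * (\<Prod>v\<in>Poly_Mapping.keys m. f v ^ Poly_Mapping.lookup m v))"

definition shift :: "('v \<Rightarrow> complex) \<Rightarrow> 'v mpoly \<Rightarrow> 'v mpoly" where
  "shift c = subst (\<lambda>v. Var v - Const (c v))"

text \<open>With \<open>'i\<close> indexing the \<open>H\<^sub>i\<close> and \<open>'n\<close> the \<open>d\<^sub>j\<close>, the algebras \<open>U(\<hh>)\<close> and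
  \<open>U(\<hh> \<oplus> D)\<close> are the polynomial algebras \<open>'i mpoly\<close> and \<open>('i + 'n) mpoly\<close>.\<close>

definition embed_h :: "'i mpoly \<Rightarrow> ('i + 'n) mpoly" where
  "embed_h = subst (\<lambda>i. Var (Inl i))"

definition sigma :: "'i \<Rightarrow> ('i + 'n) mpoly \<Rightarrow> ('i + 'n) mpoly" where
  "sigma i = shift (\<lambda>v. if v = Inl i then 1 else 0)"

text \<open>\<open>tau a\<close> is \<open>\<tau>\<^sup>a\<close>, which sends \<open>d\<^sub>j\<close> to \<open>d\<^sub>j - a\<^sub>j\<close>; see \<open>tau_axis\<close> and \<open>tau_add\<close> below.\<close>

definition tau :: "int ^ 'n::finite \<Rightarrow> ('i + 'n) mpoly \<Rightarrow> ('i + 'n) mpoly" where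
  "tau a = shift (\<lambda>v. case v of Inl i \<Rightarrow> 0 | Inr j \<Rightarrow> of_int (a $ j))"

definition lambda_power :: "complex ^ 'n::finite \<Rightarrow> int ^ 'n \<Rightarrow> complex" where
  "lambda_power lam a = (\<Prod>j\<in>UNIV. (lam $ j) powi (a $ j))"


section \<open>Modules that are free of rank one over an abelian subalgebra\<close>

text \<open>Here \<open>H\<close> is a basis of the abelian subalgebra \<open>\<bb>\<close>, so that \<open>U(\<bb>)\<close> is \<open>'i mpoly\<close>. A module
  over \<open>U(\<bb>)\<close> is free of rank one iff it is isomorphic to \<open>U(\<bb>)\<close> with left multiplication.\<close>

definition free_rank_one_module ::
    "(complex \<Rightarrow> 'g::ab_group_add \<Rightarrow> 'g) \<Rightarrow> ('g \<Rightarrow> 'g \<Rightarrow> 'g) \<Rightarrow> ('i::finite \<Rightarrow> 'g) \<Rightarrow>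
     (complex \<Rightarrow> 'v::ab_group_add \<Rightarrow> 'v) \<Rightarrow> ('g \<Rightarrow> 'v \<Rightarrow> 'v) \<Rightarrow> bool" where
  "free_rank_one_module scaleG bracket H scaleV act \<longleftrightarrow>
     lie_module scaleG bracket scaleV act \<and>
     (\<exists>\<phi> :: 'i mpoly \<Rightarrow> 'v. Vector_Spaces.linear poly_scale scaleV \<phi> \<and> bij \<phi> \<and>
        (\<forall>i f. \<phi> (Var i * f) = act (H i) (\<phi> f)))"

text \<open>The same objects after identification of the underlying space with \<open>U(\<bb>)\<close>; see
  \<open>free_rank_one_object_imp_module\<close> and \<open>free_rank_one_module_imp_object\<close> below.\<close>

definition free_rank_one_object ::
    "(complex \<Rightarrow> 'g::ab_group_add \<Rightarrow> 'g) \<Rightarrow> ('g \<Rightarrow> 'g \<Rightarrow> 'g) \<Rightarrow> ('i::finite \<Rightarrow> 'g) \<Rightarrow>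
     ('g \<Rightarrow> 'i mpoly \<Rightarrow> 'i mpoly) \<Rightarrow> bool" where
  "free_rank_one_object scaleG bracket H act \<longleftrightarrow>
     lie_module scaleG bracket poly_scale act \<and>
     (\<forall>c f. act (\<Sum>i\<in>UNIV. scaleG (c i) (H i)) f = (\<Sum>i\<in>UNIV. Const (c i) * Var i) * f)"


section \<open>The toroidal Lie algebra\<close>

text \<open>Multiplication in \<open>'n laurent\<close> is convolution, and \<open>t\<^sup>m\<close> is \<open>tpow m\<close>.\<close>

type_synonym 'n laurent = "(int ^ 'n) \<Rightarrow>\<^sub>0 complex"

definition tpow :: "int ^ 'n \<Rightarrow> 'n laurent" where
  "tpow m = Poly_Mapping.single m 1"

text \<open>\<open>\<Omega>\<^sub>A\<close> is \<open>'n laurent ^ 'n\<close>, with \<open>K\<^sub>i\<close> the \<open>i\<close>-th standard basis vector.\<close>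

definition omega_scale :: "complex \<Rightarrow> 'n::finite laurent ^ 'n \<Rightarrow> 'n laurent ^ 'n" where
  "omega_scale c w = Const c *s w"

text \<open>\<open>omega_elt a m\<close> is \<open>\<Sum>\<^sub>i a\<^sub>i t\<^sup>m K\<^sub>i\<close>.\<close>

definition omega_elt :: "int ^ 'n::finite \<Rightarrow> int ^ 'n \<Rightarrow> 'n laurent ^ 'n" where
  "omega_elt a m = (\<Sum>i\<in>UNIV. omega_scale (of_int (a $ i)) (tpow m *s axis i 1))"

definition dA :: "('n::finite laurent ^ 'n) set" where
  "dA = module.span omega_scale (range (\<lambda>m. omega_elt m m))"

lemma vector_space_omega: "vector_space (omega_scale :: _ \<Rightarrow> 'n::finite laurent ^ 'n \<Rightarrow> _)"
  by unfold_locales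
     (simp_all add: omega_scale_def Const_def vec_eq_iff vector_scalar_mult_def single_add
        algebra_simps mult_single flip: mult.assoc)

interpretation omega: vector_space "omega_scale :: _ \<Rightarrow> 'n::finite laurent ^ 'n \<Rightarrow> _"
  by (rule vector_space_omega)

lemma dA_subspace: "omega.subspace dA"
  by (simp add: dA_def)

text \<open>\<open>\<K>\<^sub>A = \<Omega>\<^sub>A / dA\<close>\<close>

quotient_type (overloaded) 'n center = "'n::finite laurent ^ 'n" / "\<lambda>v w. v - w \<in> dA"
proof (rule equivpI)
  show "reflp (\<lambda>v w. v - w \<in> (dA :: ('n laurent ^ 'n) set))"
    by (auto simp: reflp_def omega.subspace_0[OF dA_subspace])
  show "symp (\<lambda>v w. v - w \<in> (dA :: ('n laurent ^ 'n) set))"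
  proof (rule sympI)
    fix v w :: "'n laurent ^ 'n"
    assume "v - w \<in> dA"
    from omega.subspace_neg[OF dA_subspace this] show "w - v \<in> dA" by simp
  qed
  show "transp (\<lambda>v w. v - w \<in> (dA :: ('n laurent ^ 'n) set))"
  proof (rule transpI)
    fix u v w :: "'n laurent ^ 'n"
    assume "u - v \<in> dA" "v - w \<in> dA"
    from omega.subspace_add[OF dA_subspace this] show "u - w \<in> dA" by simp
  qed
qed

instantiation center :: (finite) ab_group_add
begin

lift_definition zero_center :: "'a center" is 0 .

lift_definition plus_center :: "'a center \<Rightarrow> 'a center \<Rightarrow> 'a center" is "(+)"
proof -
  fix u v w z :: "'a laurent ^ 'a"
  assume "u - v \<in> dA" "w - z \<in> dA"
  from omega.subspace_add[OF dA_subspace this] show "u + w - (v + z) \<in> dA"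
    by (simp only: add_diff_add)
qed

lift_definition minus_center :: "'a center \<Rightarrow> 'a center \<Rightarrow> 'a center" is "(-)"
proof -
  fix u v w z :: "'a laurent ^ 'a"
  assume "u - v \<in> dA" "w - z \<in> dA"
  from omega.subspace_diff[OF dA_subspace this] show "u - w - (v - z) \<in> dA"
    by (simp add: algebra_simps)
qed

lift_definition uminus_center :: "'a center \<Rightarrow> 'a center" is "uminus"
proof -
  fix u v :: "'a laurent ^ 'a"
  assume "u - v \<in> dA"
  from omega.subspace_neg[OF dA_subspace this] show "- u - - v \<in> dA" by simp
qed

instance
  by standard (transfer; simp add: omega.subspace_0[OF dA_subspace] algebra_simps)+

end

lift_definition center_scale :: "complex \<Rightarrow> 'n::finite center \<Rightarrow> 'n center" is omega_scale
proof -
  fix c and v w :: "'n laurent ^ 'n"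
  assume "v - w \<in> dA"
  from omega.subspace_scale[OF dA_subspace this, of c]
  show "omega_scale c v - omega_scale c w \<in> dA"
    by (simp only: omega.scale_right_diff_distrib)
qed

text \<open>\<open>pairing \<delta> a\<close> is the degree-\<open>a\<close> eigenvalue of \<open>\<delta> = \<Sum>\<^sub>j \<delta>\<^sub>j d\<^sub>j\<close>; on each component of \<open>\<Omega>\<^sub>A\<close>
  \<open>d\<^sub>j\<close> is \<open>t\<^sub>j \<partial>/\<partial>t\<^sub>j\<close>.\<close>

definition pairing :: "complex ^ 'n::finite \<Rightarrow> int ^ 'n \<Rightarrow> complex" where
  "pairing \<delta> a = (\<Sum>j\<in>UNIV. \<delta> $ j * of_int (a $ j))"

definition omega_deriv :: "complex ^ 'n::finite \<Rightarrow> 'n laurent ^ 'n \<Rightarrow> 'n laurent ^ 'n" where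
  "omega_deriv \<delta> w = (\<chi> i. Poly_Mapping.mapp (\<lambda>a c. pairing \<delta> a * c) (w $ i))"

lemma lookup_omega_deriv:
  "Poly_Mapping.lookup (omega_deriv \<delta> w $ i) a = pairing \<delta> a * Poly_Mapping.lookup (w $ i) a"
  by (simp add: omega_deriv_def lookup_mapp in_keys_iff when_def)

lemma omega_eqI:
  assumes "\<And>i a. Poly_Mapping.lookup (v $ i) a = Poly_Mapping.lookup (w $ i) a"
  shows "v = (w :: 'n laurent ^ 'n)"
  using assms by (simp add: vec_eq_iff poly_mapping_eq_iff fun_eq_iff)

lemma omega_deriv_add: "omega_deriv \<delta> (v + w) = omega_deriv \<delta> v + omega_deriv \<delta> w"
  by (rule omega_eqI) (simp add: lookup_omega_deriv lookup_add algebra_simps)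

lemma lookup_Const_times: "Poly_Mapping.lookup (Const c * p) a = c * Poly_Mapping.lookup p a"
  for p :: "'a::comm_monoid_add \<Rightarrow>\<^sub>0 complex"
  by (simp add: Const_def flip: mult_map_scale_conv_mult) (simp add: map.rep_eq when_def)

lemma omega_deriv_scale: "omega_deriv \<delta> (omega_scale c w) = omega_scale c (omega_deriv \<delta> w)"
  by (rule omega_eqI) (simp add: lookup_omega_deriv omega_scale_def lookup_Const_times)

lemma omega_deriv_linear: "Vector_Spaces.linear omega_scale omega_scale (omega_deriv \<delta>)"
  by unfold_locales (simp_all add: omega_deriv_add omega_deriv_scale)

lemma omega_elt_nth: "omega_elt a m $ i = Poly_Mapping.single m (of_int (a $ i))"
proof -
  have "omega_elt a m $ i = (\<Sum>j\<in>UNIV. if j = i then Poly_Mapping.single m (of_int (a $ j)) else 0)"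
    unfolding omega_elt_def sum_component
    by (rule sum.cong)
       (auto simp: omega_scale_def Const_def tpow_def axis_def mult_single simp del: single_of_int)
  then show ?thesis by simp
qed

lemma omega_deriv_elt: "omega_deriv \<delta> (omega_elt a m) = omega_scale (pairing \<delta> m) (omega_elt a m)"
  by (rule omega_eqI)
     (auto simp: lookup_omega_deriv omega_scale_def lookup_Const_times omega_elt_nth lookup_single when_def
       simp del: single_of_int)

lemma omega_deriv_dA:
  assumes "w \<in> dA" shows "omega_deriv \<delta> w \<in> dA"
proof -
  interpret D: Vector_Spaces.linear omega_scale omega_scale "omega_deriv \<delta>"
    by (rule omega_deriv_linear)
  have "w \<in> omega.span (range (\<lambda>m. omega_elt m m))" using assms by (simp add: dA_def)
  then show ?thesis
  proof (induction rule: omega.span_induct_alt)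
    case base
    show ?case using omega.subspace_0[OF dA_subspace] D.zero by simp
  next
    case (step c x y)
    then obtain m where "x = omega_elt m m" by auto
    then have "omega_deriv \<delta> x \<in> dA"
      by (simp add: omega_deriv_elt dA_def omega.span_scale omega.span_base)
    with step show ?case
      by (simp add: omega_deriv_add omega_deriv_scale omega.subspace_add[OF dA_subspace]
          omega.subspace_scale[OF dA_subspace])
  qed
qed

lift_definition center_deriv :: "complex ^ 'n::finite \<Rightarrow> 'n center \<Rightarrow> 'n center" is omega_deriv
proof -
  fix \<delta> :: "complex ^ 'n" and v w :: "'n laurent ^ 'n"
  interpret D: Vector_Spaces.linear omega_scale omega_scale "omega_deriv \<delta>"
    by (rule omega_deriv_linear)
  assume "v - w \<in> dA"
  from omega_deriv_dA[OF this, of \<delta>] show "omega_deriv \<delta> v - omega_deriv \<delta> w \<in> dA"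
    by (simp add: D.diff)
qed

text \<open>\<open>(P, k, \<delta>)\<close> stands for \<open>P + k + \<Sum>\<^sub>j \<delta>\<^sub>j d\<^sub>j\<close>, where \<open>\<gg> \<otimes> A\<close> is the space of finitely supported
  functions from exponents to \<open>\<gg>\<close>.\<close>

type_synonym ('g, 'n) toroidal = "((int ^ 'n) \<Rightarrow>\<^sub>0 'g) \<times> 'n center \<times> (complex ^ 'n)"

definition loop_elt :: "int ^ 'n::finite \<Rightarrow> 'g::ab_group_add \<Rightarrow> ('g, 'n) toroidal" where
  "loop_elt a x = (Poly_Mapping.single a x, 0, 0)"

definition central_elt :: "int ^ 'n::finite \<Rightarrow> 'n \<Rightarrow> ('g::ab_group_add, 'n) toroidal" where
  "central_elt a j = (0, abs_center (tpow a *s axis j 1), 0)"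

definition degree_elt :: "'n::finite \<Rightarrow> ('g::ab_group_add, 'n) toroidal" where
  "degree_elt j = (0, 0, axis j 1)"

definition loop_scale ::
    "(complex \<Rightarrow> 'g::ab_group_add \<Rightarrow> 'g) \<Rightarrow> complex \<Rightarrow> ((int ^ 'n) \<Rightarrow>\<^sub>0 'g) \<Rightarrow> ((int ^ 'n) \<Rightarrow>\<^sub>0 'g)" where
  "loop_scale scaleG c P = Poly_Mapping.map (scaleG c) P"

definition loop_deriv ::
    "(complex \<Rightarrow> 'g::ab_group_add \<Rightarrow> 'g) \<Rightarrow> complex ^ 'n::finite \<Rightarrow> ((int ^ 'n) \<Rightarrow>\<^sub>0 'g) \<Rightarrow> ((int ^ 'n) \<Rightarrow>\<^sub>0 'g)" where
  "loop_deriv scaleG \<delta> P = Poly_Mapping.mapp (\<lambda>a. scaleG (pairing \<delta> a)) P"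

definition toroidal_scale ::
    "(complex \<Rightarrow> 'g::ab_group_add \<Rightarrow> 'g) \<Rightarrow> complex \<Rightarrow> ('g, 'n::finite) toroidal \<Rightarrow> ('g, 'n) toroidal" where
  "toroidal_scale scaleG c = (\<lambda>(P, k, \<delta>). (loop_scale scaleG c P, center_scale c k, c *s \<delta>))"

definition loop_bracket ::
    "('g::ab_group_add \<Rightarrow> 'g \<Rightarrow> 'g) \<Rightarrow>
     ((int ^ 'n::finite) \<Rightarrow>\<^sub>0 'g) \<Rightarrow> ((int ^ 'n) \<Rightarrow>\<^sub>0 'g) \<Rightarrow> ((int ^ 'n) \<Rightarrow>\<^sub>0 'g)" where
  "loop_bracket bracket P Q = (\<Sum>a\<in>Poly_Mapping.keys P. \<Sum>b\<in>Poly_Mapping.keys Q.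
     Poly_Mapping.single (a + b) (bracket (Poly_Mapping.lookup P a) (Poly_Mapping.lookup Q b)))"

definition loop_cocycle ::
    "('g::ab_group_add \<Rightarrow> 'g \<Rightarrow> complex) \<Rightarrow>
     ((int ^ 'n::finite) \<Rightarrow>\<^sub>0 'g) \<Rightarrow> ((int ^ 'n) \<Rightarrow>\<^sub>0 'g) \<Rightarrow> 'n center" where
  "loop_cocycle form P Q = abs_center (\<Sum>a\<in>Poly_Mapping.keys P. \<Sum>b\<in>Poly_Mapping.keys Q.
     omega_scale (form (Poly_Mapping.lookup P a) (Poly_Mapping.lookup Q b)) (omega_elt a (a + b)))"

definition toroidal_bracket ::
    "(complex \<Rightarrow> 'g::ab_group_add \<Rightarrow> 'g) \<Rightarrow> ('g \<Rightarrow> 'g \<Rightarrow> 'g) \<Rightarrow>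
     ('g, 'n::finite) toroidal \<Rightarrow> ('g, 'n) toroidal \<Rightarrow> ('g, 'n) toroidal" where
  "toroidal_bracket scaleG bracket = (\<lambda>(P, k, \<delta>) (Q, l, \<epsilon>).
     (loop_bracket bracket P Q + loop_deriv scaleG \<delta> Q - loop_deriv scaleG \<epsilon> P,
      loop_cocycle (lie_algebra.killing_form scaleG bracket) P Q + center_deriv \<delta> l - center_deriv \<epsilon> k,
      0))"


section \<open>The modules over the toroidal Lie algebra\<close>

text \<open>\<open>act\<close> is the action of \<open>\<gg>\<close> on \<open>U(\<hh>)\<close> and \<open>actT\<close> the action of the toroidal algebra on
  \<open>U(\<hh> \<oplus> D)\<close>. For given \<open>act\<close> and \<open>lam\<close> there is exactly one such \<open>actT\<close>; see
  \<open>toroidal_module_ex1\<close> below.\<close>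

definition toroidal_module ::
    "(complex \<Rightarrow> 'g::ab_group_add \<Rightarrow> 'g) \<Rightarrow> ('g \<Rightarrow> 'g \<Rightarrow> 'g) \<Rightarrow>
     ('i::finite \<Rightarrow> 'g) \<Rightarrow> ('i \<Rightarrow> 'g) \<Rightarrow> ('i \<Rightarrow> 'g) \<Rightarrow> complex ^ 'n::finite \<Rightarrow>
     ('g \<Rightarrow> 'i mpoly \<Rightarrow> 'i mpoly) \<Rightarrow> (('g, 'n) toroidal \<Rightarrow> ('i + 'n) mpoly \<Rightarrow> ('i + 'n) mpoly) \<Rightarrow> bool" where
  "toroidal_module scaleG bracket x y H lam act actT \<longleftrightarrow>
     lie_module (toroidal_scale scaleG) (toroidal_bracket scaleG bracket) poly_scale actT \<and>
     (\<forall>a j g. actT (central_elt a j) g = 0) \<and>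
     (\<forall>j g. actT (degree_elt j) g = Var (Inr j) * g) \<and>
     (\<forall>a c g. actT (loop_elt a (\<Sum>i\<in>UNIV. scaleG (c i) (H i))) g =
        Const (lambda_power lam a) * embed_h (\<Sum>i\<in>UNIV. Const (c i) * Var i) * tau a g) \<and>
     (\<forall>a i g. actT (loop_elt a (x i)) g =
        Const (lambda_power lam a) * sigma i (tau a g) * embed_h (act (x i) 1)) \<and>
     (\<forall>a i g. actT (loop_elt a (y i)) g =
        Const (lambda_power lam a) * inv (sigma i) (tau a g) * embed_h (act (y i) 1))"


section \<open>Facts about the definitions\<close>

subsection \<open>Polynomial substitution\<close>

lemma Const_simps [simp]:
  "Const 0 = 0" "Const 1 = 1" "Const (a + b) = Const a + Const b"
  "Const (a - b) = Const a - Const b" "Const (- a) = - Const a"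
  by (simp_all add: Const_def single_add single_diff single_uminus)

lemma Const_mult: "Const (a * b) = (Const a * Const b :: 'a::comm_monoid_add \<Rightarrow>\<^sub>0 complex)"
  by (simp add: Const_def mult_single)

lemma poly_mapping_additive_induct [case_names zero single add]:
  fixes p :: "'a \<Rightarrow>\<^sub>0 'b::comm_monoid_add"
  assumes "P 0" "\<And>k c. P (Poly_Mapping.single k c)" "\<And>p q. P p \<Longrightarrow> P q \<Longrightarrow> P (p + q)"
  shows "P p"
proof -
  have eq: "p = (\<Sum>k\<in>Poly_Mapping.keys p. Poly_Mapping.single k (Poly_Mapping.lookup p k))"
    by (auto simp: poly_mapping_eq_iff fun_eq_iff lookup_sum lookup_single when_def in_keys_iff)
  have "P (\<Sum>k\<in>A. Poly_Mapping.single k (Poly_Mapping.lookup p k))" if "finite A" for A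
    using that by induction (auto intro: assms)
  from this[of "Poly_Mapping.keys p"] show ?thesis using eq by simp
qed

lemma mpoly_induct [case_names const add var]:
  fixes p :: "'v mpoly"
  assumes "\<And>c. P (Const c)" "\<And>p q. P p \<Longrightarrow> P q \<Longrightarrow> P (p + q)" "\<And>v p. P p \<Longrightarrow> P (Var v * p)"
  shows "P p"
proof (induction p rule: poly_mapping_additive_induct)
  case (single m c)
  have "\<forall>p. P p \<longrightarrow> P (Poly_Mapping.single m 1 * p)"
  proof (induction m rule: poly_mapping_additive_induct)
    case (single v n)
    have "P (Poly_Mapping.single (Poly_Mapping.single v n) 1 * p)" if "P p" for p
    proof (induction n)
      case (Suc n)
      have "Poly_Mapping.single (Poly_Mapping.single v (Suc n)) 1 * p
          = Var v * (Poly_Mapping.single (Poly_Mapping.single v n) 1 * p)"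
        by (simp add: Var_def mult_single single_add[symmetric] flip: mult.assoc)
      with assms(3)[OF Suc] show ?case by simp
    qed (use that in simp)
    then show ?case by blast
  next
    case (add m k)
    have "Poly_Mapping.single (m + k) 1 * p = Poly_Mapping.single m 1 * (Poly_Mapping.single k 1 * p)"
      for p :: "'v mpoly"
      by (simp add: mult_single flip: mult.assoc)
    with add show ?case by simp
  qed simp
  from this[rule_format, OF assms(1)[of c]] show ?case
    by (simp add: Const_def mult_single)
next
  case zero
  show ?case using assms(1)[of 0] by simp
qed (use assms in auto)

definition mono_eval :: "('v \<Rightarrow> 'w mpoly) \<Rightarrow> ('v \<Rightarrow>\<^sub>0 nat) \<Rightarrow> 'w mpoly" where
  "mono_eval f m = (\<Prod>v\<in>Poly_Mapping.keys m. f v ^ Poly_Mapping.lookup m v)"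

lemma mono_eval_superset:
  assumes "finite A" "Poly_Mapping.keys m \<subseteq> A"
  shows "mono_eval f m = (\<Prod>v\<in>A. f v ^ Poly_Mapping.lookup m v)"
  unfolding mono_eval_def using assms
  by (intro prod.mono_neutral_left) (auto simp: in_keys_iff)

lemma mono_eval_add: "mono_eval f (m + k) = mono_eval f m * mono_eval f k"
proof -
  let ?A = "Poly_Mapping.keys m \<union> Poly_Mapping.keys k"
  have "finite ?A" by simp
  moreover have "Poly_Mapping.keys (m + k) \<subseteq> ?A" by (rule keys_add)
  ultimately show ?thesis
    by (simp add: mono_eval_superset[of ?A] lookup_add power_add prod.distrib)
qed

lemma subst_add: "subst f (p + q) = subst f p + subst f q"
  unfolding subst_def
  by (rule setsum_keys_plus_distrib) (simp_all add: algebra_simps)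

lemma subst_single: "subst f (Poly_Mapping.single m c) = Const c * mono_eval f m"
  by (simp add: subst_def mono_eval_def)

lemma subst_zero [simp]: "subst f 0 = 0"
  by (simp add: subst_def)

lemma subst_Const [simp]: "subst f (Const c) = Const c"
  unfolding Const_def[of c] subst_single by (simp add: mono_eval_def Const_def)

lemma subst_Var [simp]: "subst f (Var v) = f v"
  by (simp add: Var_def subst_single mono_eval_def)

lemma subst_mult: "subst f (p * q) = subst f p * subst f q"
proof (induction p rule: poly_mapping_additive_induct)
  case (single m c)
  show ?case
  proof (induction q rule: poly_mapping_additive_induct)
    case (single k d)
    show ?case
      by (simp add: mult_single subst_single mono_eval_add Const_mult)
  qed (simp_all add: subst_add distrib_left)
qed (simp_all add: subst_add distrib_right)

lemma subst_one [simp]: "subst f 1 = 1"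
  using subst_Const[of f 1] by simp

lemma subst_uminus: "subst f (- p) = - subst f p"
  using subst_add[of f p "- p"] by (simp add: eq_neg_iff_add_eq_0 add.commute)

lemma subst_diff: "subst f (p - q) = subst f p - subst f q"
  using subst_add[of f p "- q"] by (simp add: subst_uminus)

lemma subst_sum: "subst f (sum g A) = (\<Sum>a\<in>A. subst f (g a))"
  by (induction A rule: infinite_finite_induct) (auto simp: subst_add)

lemma subst_subst: "subst f (subst g p) = subst (\<lambda>v. subst f (g v)) p"
  by (induction p rule: mpoly_induct) (simp_all add: subst_add subst_mult)

lemma subst_id [simp]: "subst Var p = p"
  by (induction p rule: mpoly_induct) (simp_all add: subst_add subst_mult)

lemma shift_shift: "shift c (shift d p) = shift (\<lambda>v. c v + d v) p"
  by (simp add: shift_def subst_subst subst_diff algebra_simps)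

lemma shift_0 [simp]: "shift (\<lambda>_. 0) p = p"
  by (simp add: shift_def)

lemma shift_inverse: "shift c (shift (\<lambda>v. - c v) p) = p" "shift (\<lambda>v. - c v) (shift c p) = p"
  by (simp_all add: shift_shift)

lemma bij_shift: "bij (shift c)"
  by (rule bij_betw_byWitness[where f' = "shift (\<lambda>v. - c v)"]) (simp_all add: shift_inverse)

lemma inv_shift: "inv (shift c) = shift (\<lambda>v. - c v)"
  by (rule inv_equality) (simp_all add: shift_inverse)

lemma shift_hom:
  "shift c (p + q) = shift c p + shift c q" "shift c (p * q) = shift c p * shift c q"
  "shift c (Const b) = Const b" "shift c (Var v) = Var v - Const (c v)"
  by (simp_all add: shift_def subst_add subst_mult)

lemma tau_hom:
  "tau a (p + q) = tau a p + tau a q" "tau a (p * q) = tau a p * tau a q"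
  "tau a (Const b) = Const b"
  "tau a (Var (Inl i)) = Var (Inl i)" "tau a (Var (Inr j)) = Var (Inr j) - Const (of_int (a $ j))"
  by (simp_all add: tau_def shift_hom)

lemma tau_axis:
  "(tau (axis j 1) :: ('i + 'n::finite) mpoly \<Rightarrow> _) = shift (\<lambda>v. if v = Inr j then 1 else 0)"
proof -
  have "(case v of Inl i \<Rightarrow> 0 | Inr k \<Rightarrow> of_int (axis j 1 $ k)) = (if v = Inr j then 1 else (0::complex))"
    for v :: "'i + 'n"
    by (cases v) (auto simp: axis_def)
  then show ?thesis by (simp add: tau_def)
qed

lemma tau_add: "tau (a + b) g = tau a (tau b g)"
  for g :: "('i + 'n::finite) mpoly"
proof -
  have "(\<lambda>v :: 'i + 'n. case v of Inl i \<Rightarrow> 0 | Inr k \<Rightarrow> complex_of_int ((a + b) $ k))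
      = (\<lambda>v. (case v of Inl i \<Rightarrow> 0 | Inr k \<Rightarrow> of_int (a $ k)) +
        (case v of Inl i \<Rightarrow> 0 | Inr k \<Rightarrow> of_int (b $ k)))"
    by (auto simp: fun_eq_iff split: sum.split)
  then show ?thesis by (simp only: tau_def shift_shift)
qed

lemma tau_zero [simp]: "tau 0 g = g"
  for g :: "('i + 'n::finite) mpoly"
proof -
  have "(\<lambda>v :: 'i + 'n. case v of Inl i \<Rightarrow> 0 | Inr k \<Rightarrow> complex_of_int ((0 :: int ^ 'n) $ k)) = (\<lambda>_. 0)"
    by (auto simp: fun_eq_iff split: sum.split)
  then show ?thesis by (simp only: tau_def shift_0)
qed

lemma bij_tau: "bij (tau a)"
  unfolding tau_def by (rule bij_shift)

lemma bij_sigma: "bij (sigma i)"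
  unfolding sigma_def by (rule bij_shift)

lemma sigma_hom:
  "sigma i (p + q) = sigma i p + sigma i q" "sigma i (p * q) = sigma i p * sigma i q"
  "sigma i (Const b) = Const b"
  "sigma i (Var (Inl k)) = Var (Inl k) - (if k = i then 1 else 0)"
  "sigma i (Var (Inr j)) = Var (Inr j)"
  by (simp_all add: sigma_def shift_hom)

lemma inv_sigma_hom:
  "inv (sigma i) (p + q) = inv (sigma i) p + inv (sigma i) q"
  "inv (sigma i) (p * q) = inv (sigma i) p * inv (sigma i) q"
  "inv (sigma i) (Const b) = Const b"
  "inv (sigma i) (Var (Inl k)) = Var (Inl k) + (if k = i then 1 else 0)"
  "inv (sigma i) (Var (Inr j)) = Var (Inr j)"
  by (simp_all add: sigma_def inv_shift shift_hom)

lemma embed_h_hom: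
  "embed_h (p + q) = embed_h p + embed_h q" "embed_h (p * q) = embed_h p * embed_h q"
  "embed_h (Const b) = Const b" "embed_h (Var i) = Var (Inl i)" 
  "embed_h (sum f A) = (\<Sum>a\<in>A. embed_h (f a))" "embed_h (p - q) = embed_h p - embed_h q"
  by (simp_all add: embed_h_def subst_add subst_mult subst_sum subst_diff)

lemma vector_space_poly: "vector_space poly_scale"
  by unfold_locales (simp_all add: poly_scale_def algebra_simps Const_mult)

interpretation poly: vector_space poly_scale
  by (rule vector_space_poly)

lemma free_rank_one_object_imp_module:
  assumes "free_rank_one_object scaleG bracket H act"
  shows "free_rank_one_module scaleG bracket H poly_scale act"
proof -
  interpret lie_module scaleG bracket poly_scale act
    using assms by (simp add: free_rank_one_object_def)
  have "act (H i) f = Var i * f" for i f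
  proof -
    have "(\<Sum>k\<in>UNIV. scaleG (if k = i then 1 else 0) (H k)) = H i"
      by (subst sum.remove[of _ i]) auto
    moreover have "(\<Sum>k\<in>UNIV. Const (if k = i then 1 else 0) * Var k) = Var i"
      by (subst sum.remove[of _ i]) auto
    ultimately show ?thesis
      using assms unfolding free_rank_one_object_def by metis
  qed
  then show ?thesis
    unfolding free_rank_one_module_def
    by (intro conjI lie_module_axioms exI[of _ "\<lambda>f. f"]) (simp_all add: poly.linear_ident bij_def inj_def)
qed

lemma free_rank_one_module_imp_object:
  fixes H :: "'i::finite \<Rightarrow> 'g::ab_group_add" and scaleV :: "complex \<Rightarrow> 'v::ab_group_add \<Rightarrow> 'v"
  assumes "free_rank_one_module scaleG bracket H scaleV act"
  obtains \<phi> act' where "Vector_Spaces.linear poly_scale scaleV \<phi>" "bij \<phi>"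
    "\<And>x f. \<phi> (act' x f) = act x (\<phi> f)" "free_rank_one_object scaleG bracket H act'"
proof -
  interpret lie_module scaleG bracket scaleV act
    using assms by (simp add: free_rank_one_module_def)
  obtain \<phi> :: "'i mpoly \<Rightarrow> 'v" where \<phi>: "Vector_Spaces.linear poly_scale scaleV \<phi>" "bij \<phi>"
    "\<And>i f. \<phi> (Var i * f) = act (H i) (\<phi> f)"
    using assms by (auto simp: free_rank_one_module_def)
  interpret \<phi>: Vector_Spaces.linear poly_scale scaleV \<phi> by fact
  interpret left: Vector_Spaces.linear scaleG scaleV "\<lambda>x. act x v" for v by (rule act_linear_left)
  interpret right: Vector_Spaces.linear scaleV scaleV "act x" for x by (rule act_linear_right)
  define act' where "act' x f = inv \<phi> (act x (\<phi> f))" for x f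
  have act': "\<phi> (act' x f) = act x (\<phi> f)" for x f
    unfolding act'_def using \<phi>(2) by (simp add: bij_is_surj surj_f_inv_f)
  have inj: "p = q" if "\<phi> p = \<phi> q" for p q
    using \<phi>(2) that by (simp add: bij_is_inj inj_eq)
  have "lie_module scaleG bracket poly_scale act'"
  proof unfold_locales
    show "act' (bracket x y) v = act' x (act' y v) - act' y (act' x v)" for x y v
      by (rule inj) (simp add: act' \<phi>.diff act_bracket)
  qed ((rule inj, simp add: act' \<phi>.add \<phi>.scale left.add left.scale right.add right.scale)+)
  moreover have "act' (\<Sum>i\<in>UNIV. scaleG (c i) (H i)) f = (\<Sum>i\<in>UNIV. Const (c i) * Var i) * f" for c f
  proof (rule inj)
    have "\<phi> ((\<Sum>i\<in>UNIV. Const (c i) * Var i) * f) = (\<Sum>i\<in>UNIV. \<phi> (poly_scale (c i) (Var i * f)))"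
      by (simp add: sum_distrib_right \<phi>.sum poly_scale_def mult.assoc)
    also have "\<dots> = (\<Sum>i\<in>UNIV. scaleV (c i) (act (H i) (\<phi> f)))"
      by (simp only: \<phi>.scale \<phi>(3))
    finally show "\<phi> (act' (\<Sum>i\<in>UNIV. scaleG (c i) (H i)) f)
        = \<phi> ((\<Sum>i\<in>UNIV. Const (c i) * Var i) * f)"
      by (simp add: act' left.sum left.scale)
  qed
  ultimately have "free_rank_one_object scaleG bracket H act'"
    by (simp add: free_rank_one_object_def)
  with \<phi>(1,2) act' show ?thesis using that by blast
qed

subsection \<open>The toroidal bracket is a Lie bracket\<close>

lemma vector_space_center: "vector_space center_scale"
  by unfold_locales
     (transfer; simp add: omega.scale_right_distrib omega.scale_left_distrib
        omega.subspace_0[OF dA_subspace])+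

interpretation center: vector_space "center_scale :: _ \<Rightarrow> 'n::finite center \<Rightarrow> _"
  by (rule vector_space_center)

lemma center_deriv_linear: "Vector_Spaces.linear center_scale center_scale (center_deriv \<delta>)"
  by unfold_locales
     (transfer; simp add: omega_deriv_add omega_deriv_scale omega.subspace_0[OF dA_subspace])+

interpretation center_deriv: Vector_Spaces.linear center_scale center_scale
    "center_deriv \<delta> :: 'n::finite center \<Rightarrow> _"
  by (rule center_deriv_linear)

lemma pairing_add: "pairing (\<delta> + \<epsilon>) a = pairing \<delta> a + pairing \<epsilon> a"
  "pairing \<delta> (a + b) = pairing \<delta> a + pairing \<delta> b"
  "pairing (c *s \<delta>) a = c * pairing \<delta> a" "pairing 0 a = 0" "pairing \<delta> 0 = 0"
  by (simp_all add: pairing_def algebra_simps sum.distrib sum_distrib_left)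

lemma center_deriv_left:
  "center_deriv (\<delta> + \<epsilon>) k = center_deriv \<delta> k + center_deriv \<epsilon> k"
  "center_deriv (c *s \<delta>) k = center_scale c (center_deriv \<delta> k)"
  "center_deriv 0 k = 0"
  "center_deriv \<delta> (center_deriv \<epsilon> k) = center_deriv \<epsilon> (center_deriv \<delta> k)"
proof -
  have "omega_deriv (\<delta> + \<epsilon>) w = omega_deriv \<delta> w + omega_deriv \<epsilon> w"
    "omega_deriv (c *s \<delta>) w = omega_scale c (omega_deriv \<delta> w)" "omega_deriv 0 w = 0"
    "omega_deriv \<delta> (omega_deriv \<epsilon> w) = omega_deriv \<epsilon> (omega_deriv \<delta> w)" for w
    by (rule omega_eqI;
        simp add: lookup_omega_deriv pairing_add lookup_add omega_scale_def lookup_Const_times algebra_simps)+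
  then show
    "center_deriv (\<delta> + \<epsilon>) k = center_deriv \<delta> k + center_deriv \<epsilon> k"
    "center_deriv (c *s \<delta>) k = center_scale c (center_deriv \<delta> k)"
    "center_deriv 0 k = 0"
    "center_deriv \<delta> (center_deriv \<epsilon> k) = center_deriv \<epsilon> (center_deriv \<delta> k)"
    by (transfer; simp add: omega.subspace_0[OF dA_subspace])+
qed

definition center_elt :: "int ^ 'n::finite \<Rightarrow> int ^ 'n \<Rightarrow> 'n center" where
  "center_elt a m = abs_center (omega_elt a m)"

lemma center_elt_add: "center_elt (a + b) m = center_elt a m + center_elt b m"
proof -
  have "omega_elt (a + b) m = omega_elt a m + omega_elt b m"
    by (simp add: omega_elt_def omega.scale_left_distrib sum.distrib)
  then show ?thesis by (simp add: center_elt_def plus_center.abs_eq)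
qed

lemma center_elt_self: "center_elt m m = 0"
proof -
  have "omega_elt m m \<in> dA" unfolding dA_def by (rule omega.span_base) auto
  then show ?thesis by (simp add: center_elt_def zero_center_def center.abs_eq_iff)
qed

lemma center_elt_swap: "center_elt b (a + b) = - center_elt a (a + b)"
  using center_elt_add[of a b "a + b"] center_elt_self[of "a + b"]
  by (simp add: eq_neg_iff_add_eq_0 add.commute)

lemma center_deriv_elt: "center_deriv \<delta> (center_elt a m) = center_scale (pairing \<delta> m) (center_elt a m)"
  unfolding center_elt_def by (simp add: center_deriv.abs_eq center_scale.abs_eq omega_deriv_elt)

lemma abs_center_sum: "abs_center (sum f A) = (\<Sum>a\<in>A. abs_center (f a))"
  by (induction A rule: infinite_finite_induct)
     (simp_all add: zero_center_def plus_center.abs_eq[symmetric])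

lemma loop_cocycle_alt:
  "loop_cocycle form P Q = (\<Sum>a\<in>Poly_Mapping.keys P. \<Sum>b\<in>Poly_Mapping.keys Q.
     center_scale (form (Poly_Mapping.lookup P a) (Poly_Mapping.lookup Q b)) (center_elt a (a + b)))"
  by (simp add: loop_cocycle_def abs_center_sum center_elt_def center_scale.abs_eq)

lemma toroidal_induct [case_names add loop central degree]:
  fixes u :: "('g::ab_group_add, 'n::finite) toroidal"
  assumes add: "\<And>u v. P u \<Longrightarrow> P v \<Longrightarrow> P (u + v)" and loop: "\<And>a x. P (loop_elt a x)"
    and central: "\<And>k. P (0, k, 0)" and degree: "\<And>\<delta>. P (0, 0, \<delta>)"
  shows "P u"
proof -
  obtain p k \<delta> where u: "u = (p, k, \<delta>)" by (cases u)
  have "P (p, 0, 0)"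
  proof (induction p rule: poly_mapping_additive_induct)
    case zero
    show ?case using central[of 0] .
  next
    case (single k c)
    show ?case using loop[of k c] by (simp add: loop_elt_def)
  next
    case (add p q)
    show ?case using assms(1)[OF add] by simp
  qed
  from add[OF add[OF this central[of k]] degree[of \<delta>]] show ?thesis by (simp add: u)
qed

context lie_algebra
begin

sublocale bracket_left: Vector_Spaces.linear scaleG scaleG "\<lambda>x. bracket x y" for y
  by (rule bracket_linear_left)

sublocale bracket_right: Vector_Spaces.linear scaleG scaleG "bracket x" for x
  by (rule bracket_linear_right)

lemma bracket_antisym: "bracket y x = - bracket x y"
  using bracket_alternating[of "x + y"] bracket_alternating[of x] bracket_alternating[of y]
  by (simp add: bracket_left.add bracket_right.add eq_neg_iff_add_eq_0)

lemma lookup_loop_scale [simp]: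
  "Poly_Mapping.lookup (loop_scale scaleG c P) a = scaleG c (Poly_Mapping.lookup P a)"
  by (simp add: loop_scale_def map.rep_eq when_def)

lemma lookup_loop_deriv [simp]:
  "Poly_Mapping.lookup (loop_deriv scaleG \<delta> P) a = scaleG (pairing \<delta> a) (Poly_Mapping.lookup P a)"
  by (simp add: loop_deriv_def lookup_mapp in_keys_iff when_def)

lemma poly_mapping_lookupI: "(\<And>a. Poly_Mapping.lookup p a = Poly_Mapping.lookup q a) \<Longrightarrow> p = q"
  by (simp add: poly_mapping_eq_iff fun_eq_iff)

lemma loop_scale_simps:
  "loop_scale scaleG c (P + Q) = loop_scale scaleG c P + loop_scale scaleG c Q"
  "loop_scale scaleG c (P - Q) = loop_scale scaleG c P - loop_scale scaleG c Q"
  "loop_scale scaleG (c + d) P = loop_scale scaleG c P + loop_scale scaleG d P"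
  "loop_scale scaleG c (loop_scale scaleG d P) = loop_scale scaleG (c * d) P"
  "loop_scale scaleG 1 P = P" "loop_scale scaleG c 0 = 0"
  "loop_scale scaleG c (Poly_Mapping.single a x) = Poly_Mapping.single a (scaleG c x)"
  by (rule poly_mapping_lookupI;
      simp add: lookup_add lookup_minus scale_right_distrib scale_left_distrib scale_right_diff_distrib
        lookup_single when_def)+

lemma loop_deriv_simps:
  "loop_deriv scaleG \<delta> (P + Q) = loop_deriv scaleG \<delta> P + loop_deriv scaleG \<delta> Q"
  "loop_deriv scaleG (\<delta> + \<epsilon>) P = loop_deriv scaleG \<delta> P + loop_deriv scaleG \<epsilon> P"
  "loop_deriv scaleG \<delta> (loop_scale scaleG c P) = loop_scale scaleG c (loop_deriv scaleG \<delta> P)"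
  "loop_deriv scaleG (c *s \<delta>) P = loop_scale scaleG c (loop_deriv scaleG \<delta> P)"
  "loop_deriv scaleG 0 P = 0" "loop_deriv scaleG \<delta> 0 = 0"
  "loop_deriv scaleG \<delta> (Poly_Mapping.single a x) = Poly_Mapping.single a (scaleG (pairing \<delta> a) x)"
  by (rule poly_mapping_lookupI;
      simp add: lookup_add scale_right_distrib scale_left_distrib pairing_add mult.commute
        lookup_single when_def)+

lemma vector_space_toroidal:
  "vector_space (toroidal_scale scaleG :: complex \<Rightarrow> ('g, 'n::finite) toroidal \<Rightarrow> _)"
  by unfold_locales
     (auto simp: toroidal_scale_def loop_scale_simps center.scale_right_distrib
        center.scale_left_distrib vec_eq_iff algebra_simps)

lemma loop_bracket_add_left:
  "loop_bracket bracket (P + Q) R = loop_bracket bracket P R + loop_bracket bracket Q R"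
  unfolding loop_bracket_def
  by (rule setsum_keys_plus_distrib) (simp_all add: bracket_left.zero bracket_left.add single_add sum.distrib)

lemma loop_bracket_add_right:
  "loop_bracket bracket P (Q + R) = loop_bracket bracket P Q + loop_bracket bracket P R"
  unfolding loop_bracket_def sum.distrib[symmetric]
  by (intro sum.cong setsum_keys_plus_distrib refl)
     (simp_all add: bracket_right.zero bracket_right.add single_add)

lemma loop_bracket_zero [simp]: "loop_bracket bracket 0 P = 0" "loop_bracket bracket P 0 = 0"
  by (simp_all add: loop_bracket_def)

lemma loop_bracket_single:
  "loop_bracket bracket (Poly_Mapping.single a x) (Poly_Mapping.single b y)
     = Poly_Mapping.single (a + b) (bracket x y)"
  by (auto simp: loop_bracket_def bracket_left.zero bracket_right.zero)

lemma loop_bracket_scale_left: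
  "loop_bracket bracket (loop_scale scaleG c P) Q = loop_scale scaleG c (loop_bracket bracket P Q)"
proof (induction P rule: poly_mapping_additive_induct)
  case (single a x)
  show ?case
    by (induction Q rule: poly_mapping_additive_induct)
       (simp_all add: loop_scale_simps loop_bracket_single loop_bracket_add_right bracket_left.scale)
qed (simp_all add: loop_scale_simps loop_bracket_add_left)

lemma loop_bracket_scale_right:
  "loop_bracket bracket P (loop_scale scaleG c Q) = loop_scale scaleG c (loop_bracket bracket P Q)"
proof (induction P rule: poly_mapping_additive_induct)
  case (single a x)
  show ?case
    by (induction Q rule: poly_mapping_additive_induct)
       (simp_all add: loop_scale_simps loop_bracket_single loop_bracket_add_right bracket_right.scale)
qed (simp_all add: loop_scale_simps loop_bracket_add_left)

end

context simple_lie_algebra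
begin

definition some_basis :: "'a set" where
  "some_basis = (SOME B. independent B \<and> span B = UNIV)"

lemma some_basis: "independent some_basis" "span some_basis = UNIV" "finite some_basis"
proof -
  have "\<exists>B. independent B \<and> span B = UNIV"
    by (metis independent_empty independent_extend_basis span_extend_basis)
  from someI_ex[OF this] show ind: "independent some_basis" and "span some_basis = UNIV"
    by (simp_all add: some_basis_def)
  from finite_dim obtain B where "finite B" "span B = UNIV" by blast
  then show "finite some_basis"
    using independent_span_bound[OF \<open>finite B\<close> ind] by simp
qed

abbreviation coord :: "'a \<Rightarrow> 'a \<Rightarrow> complex" where
  "coord \<equiv> representation some_basis"

lemma coord_sum: "(\<Sum>b\<in>some_basis. scaleG (coord v b) b) = v"
  by (rule sum_representation_eq) (simp_all add: some_basis)

lemma coord_add: "coord (u + v) b = coord u b + coord v b"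
  by (simp add: representation_add some_basis)

lemma coord_scale: "coord (scaleG c v) b = c * coord v b"
  by (simp add: representation_scale some_basis)

lemma coord_diff: "coord (u - v) b = coord u b - coord v b"
  by (simp add: representation_diff some_basis)

lemma coord_sum_distrib: "coord (sum f A) b = (\<Sum>a\<in>A. coord (f a) b)"
proof -
  interpret Vector_Spaces.linear scaleG "(*)" "\<lambda>v. coord v b"
    by (rule linear_representation) (simp_all add: some_basis)
  show ?thesis by (rule sum)
qed

lemma trace_of_alt: "trace_of f = (\<Sum>b\<in>some_basis. coord (f b) b)"
  by (simp add: trace_of_def Let_def some_basis_def)

lemma trace_of_swap:
  assumes "Vector_Spaces.linear scaleG scaleG f" "Vector_Spaces.linear scaleG scaleG g"
  shows "trace_of (\<lambda>z. f (g z)) = trace_of (\<lambda>z. g (f z))"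
proof -
  have expand: "trace_of (\<lambda>z. f (g z)) = (\<Sum>b\<in>some_basis. \<Sum>c\<in>some_basis. coord (g b) c * coord (f c) b)"
    if "Vector_Spaces.linear scaleG scaleG f" for f g :: "'a \<Rightarrow> 'a"
  proof -
    interpret Vector_Spaces.linear scaleG scaleG f by fact
    have "coord (f (g b)) b = (\<Sum>c\<in>some_basis. coord (g b) c * coord (f c) b)" for b
      by (subst coord_sum[of "g b", symmetric]) (simp only: sum scale coord_sum_distrib coord_scale)
    then show ?thesis by (simp add: trace_of_alt)
  qed
  show ?thesis
    unfolding expand[OF assms(1)] expand[OF assms(2)]
    by (subst sum.swap) (simp add: mult.commute)
qed

lemma killing_form_simps:
  "killing_form (x + y) z = killing_form x z + killing_form y z"
  "killing_form z (x + y) = killing_form z x + killing_form z y"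
  "killing_form (scaleG c x) z = c * killing_form x z"
  "killing_form z (scaleG c x) = c * killing_form z x"
  by (simp_all add: killing_form_def trace_of_alt bracket_left.add bracket_right.add coord_add
      sum.distrib bracket_left.scale bracket_right.scale coord_scale sum_distrib_left)

lemma killing_form_zero [simp]: "killing_form 0 z = 0" "killing_form z 0 = 0"
  using killing_form_simps(3,4)[where c = 0 and x = 0] by simp_all

lemma killing_form_sym: "killing_form x y = killing_form y x"
  unfolding killing_form_def
  by (rule trace_of_swap) (rule bracket_linear_right)+

lemma bracket_bracket: "bracket (bracket x y) z = bracket x (bracket y z) - bracket y (bracket x z)"
  using jacobi[of x y z] bracket_antisym[of z "bracket x y"] bracket_antisym[of z x]
  by (simp add: bracket_right.neg algebra_simps eq_neg_iff_add_eq_0)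

lemma killing_form_invariant: "killing_form (bracket x y) z = killing_form x (bracket y z)"
proof -
  have "trace_of (\<lambda>w. bracket y (bracket x (bracket z w))) = trace_of (\<lambda>w. bracket x (bracket z (bracket y w)))"
    by (rule trace_of_swap[where f = "bracket y" and g = "\<lambda>w. bracket x (bracket z w)"])
       (use Vector_Spaces.linear_compose[OF bracket_linear_right bracket_linear_right] bracket_linear_right in
         \<open>simp_all add: comp_def\<close>)
  then show ?thesis
    by (simp add: killing_form_def bracket_bracket bracket_right.diff trace_of_alt coord_diff sum_subtractf)
qed

lemma loop_cocycle_add_left:
  "loop_cocycle killing_form (P + Q) R = loop_cocycle killing_form P R + loop_cocycle killing_form Q R"
  unfolding loop_cocycle_alt
  by (rule setsum_keys_plus_distrib) (simp_all add: killing_form_simps center.scale_left_distrib sum.distrib)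

lemma loop_cocycle_add_right:
  "loop_cocycle killing_form P (Q + R) = loop_cocycle killing_form P Q + loop_cocycle killing_form P R"
  unfolding loop_cocycle_alt sum.distrib[symmetric]
  by (intro sum.cong setsum_keys_plus_distrib refl)
     (simp_all add: killing_form_simps center.scale_left_distrib)

lemma loop_cocycle_zero [simp]: "loop_cocycle killing_form 0 P = 0" "loop_cocycle killing_form P 0 = 0"
  by (simp_all add: loop_cocycle_alt)

lemma loop_cocycle_single:
  "loop_cocycle killing_form (Poly_Mapping.single a x) (Poly_Mapping.single b y)
     = center_scale (killing_form x y) (center_elt a (a + b))"
  by (auto simp: loop_cocycle_alt)

lemma loop_cocycle_scale_left:
  "loop_cocycle killing_form (loop_scale scaleG c P) Q = center_scale c (loop_cocycle killing_form P Q)"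
proof (induction P rule: poly_mapping_additive_induct)
  case (single a x)
  show ?case
    by (induction Q rule: poly_mapping_additive_induct)
       (simp_all add: loop_scale_simps loop_cocycle_single loop_cocycle_add_right killing_form_simps
         center.scale_right_distrib)
qed (simp_all add: loop_scale_simps loop_cocycle_add_left center.scale_right_distrib)

lemma loop_cocycle_scale_right:
  "loop_cocycle killing_form P (loop_scale scaleG c Q) = center_scale c (loop_cocycle killing_form P Q)"
proof (induction P rule: poly_mapping_additive_induct)
  case (single a x)
  show ?case
    by (induction Q rule: poly_mapping_additive_induct)
       (simp_all add: loop_scale_simps loop_cocycle_single loop_cocycle_add_right killing_form_simps
         center.scale_right_distrib)
qed (simp_all add: loop_scale_simps loop_cocycle_add_left center.scale_right_distrib)

abbreviation tbracket :: "('a, 'n::finite) toroidal \<Rightarrow> ('a, 'n) toroidal \<Rightarrow> ('a, 'n) toroidal" where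
  "tbracket \<equiv> toroidal_bracket scaleG bracket"

lemma tbracket_linear_left:
  "Vector_Spaces.linear (toroidal_scale scaleG) (toroidal_scale scaleG) (\<lambda>u. tbracket u v)"
  by (intro Vector_Spaces.linear.intro vector_space_toroidal module_hom.intro
      vector_space_toroidal[folded module_iff_vector_space] module_hom_axioms.intro)
     (auto simp: toroidal_bracket_def toroidal_scale_def loop_bracket_add_left loop_cocycle_add_left
       loop_bracket_scale_left loop_cocycle_scale_left loop_deriv_simps loop_scale_simps center_deriv_left
       center_deriv.add center_deriv.scale center.scale_right_distrib center.scale_right_diff_distrib
       split: prod.split)

lemma tbracket_linear_right:
  "Vector_Spaces.linear (toroidal_scale scaleG) (toroidal_scale scaleG) (tbracket u)"
  by (intro Vector_Spaces.linear.intro vector_space_toroidal module_hom.intro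
      vector_space_toroidal[folded module_iff_vector_space] module_hom_axioms.intro)
     (auto simp: toroidal_bracket_def toroidal_scale_def loop_bracket_add_right loop_cocycle_add_right
       loop_bracket_scale_right loop_cocycle_scale_right loop_deriv_simps loop_scale_simps center_deriv_left
       center_deriv.add center_deriv.scale center.scale_right_distrib center.scale_right_diff_distrib
       split: prod.split)

lemma loop_elt_simps:
  "loop_elt a (x + y) = loop_elt a x + loop_elt a y" "loop_elt a (- x) = - loop_elt a x"
  "loop_elt a 0 = 0" "loop_elt a (x - y) = loop_elt a x - loop_elt a y"
  by (simp_all add: loop_elt_def single_add single_uminus single_diff zero_prod_def)

lemma tbracket_simps:
  "tbracket (loop_elt a x) (loop_elt b y) = loop_elt (a + b) (bracket x y) +
     (0, center_scale (killing_form x y) (center_elt a (a + b)), 0)"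
  "tbracket (0, 0, \<delta>) (loop_elt a x) = loop_elt a (scaleG (pairing \<delta> a) x)"
  "tbracket (loop_elt a x) (0, 0, \<delta>) = - loop_elt a (scaleG (pairing \<delta> a) x)"
  "tbracket (0, 0, \<delta>) (0, k, 0) = (0, center_deriv \<delta> k, 0)"
  "tbracket (0, k, 0) (0, 0, \<delta>) = - (0, center_deriv \<delta> k, 0)"
  "tbracket (0, k, 0) (loop_elt a x) = 0"
  "tbracket (loop_elt a x) (0, k, 0) = 0"
  "tbracket (0, k, 0) (0, l, 0) = 0"
  "tbracket (0, 0, \<delta>) (0, 0, \<epsilon>) = 0"
  by (simp_all add: toroidal_bracket_def loop_elt_def loop_bracket_single loop_cocycle_single
      loop_deriv_simps center_deriv_left center_deriv.zero zero_prod_def pairing_add)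

lemma tbracket_antisym:
  fixes u v :: "('a, 'n::finite) toroidal"
  shows "tbracket u v = - tbracket v u"
proof -
  interpret l: Vector_Spaces.linear "toroidal_scale scaleG" "toroidal_scale scaleG" "\<lambda>u. tbracket u z"
    for z :: "('a, 'n) toroidal" by (rule tbracket_linear_left)
  interpret r: Vector_Spaces.linear "toroidal_scale scaleG" "toroidal_scale scaleG" "tbracket z"
    for z :: "('a, 'n) toroidal" by (rule tbracket_linear_right)
  note linear_simps = l.add r.add
  have LL: "tbracket (loop_elt a x) (loop_elt b y) = - tbracket (loop_elt b y) (loop_elt a x)"
    for a b :: "int ^ 'n" and x y
    using center_elt_swap[of b a] killing_form_sym[of x y] bracket_antisym[of x y]
    by (simp add: tbracket_simps loop_elt_simps add.commute)
  show ?thesis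
  proof (induction u rule: toroidal_induct)
    case (loop a x)
    show ?case
    proof (induction v rule: toroidal_induct)
      case (loop b y)
      show ?case by (rule LL)
    qed (simp_all add: linear_simps tbracket_simps)
  next
    case (central k)
    show ?case
      by (induction v rule: toroidal_induct) (simp_all add: linear_simps tbracket_simps)
  next
    case (degree k)
    show ?case
      by (induction v rule: toroidal_induct) (simp_all add: linear_simps tbracket_simps)
  qed (simp add: linear_simps)
qed

lemma tbracket_alternating:
  fixes u :: "('a, 'n::finite) toroidal"
  shows "tbracket u u = 0"
proof -
  interpret T: vector_space "toroidal_scale scaleG :: complex \<Rightarrow> ('a, 'n) toroidal \<Rightarrow> _"
    by (rule vector_space_toroidal)
  have "tbracket u u + tbracket u u = 0"
    using tbracket_antisym[of u u] by (simp add: eq_neg_iff_add_eq_0)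
  then have "toroidal_scale scaleG 2 (tbracket u u) = 0"
    using T.scale_left_distrib[of 1 1] by simp
  then show ?thesis by simp
qed

lemma tbracket_jacobi:
  fixes u v w :: "('a, 'n::finite) toroidal"
  shows "tbracket u (tbracket v w) + tbracket v (tbracket w u) + tbracket w (tbracket u v) = 0"
    (is "?J u v w = 0")
proof -
  interpret l: Vector_Spaces.linear "toroidal_scale scaleG" "toroidal_scale scaleG" "\<lambda>u. tbracket u z"
    for z :: "('a, 'n) toroidal" by (rule tbracket_linear_left)
  interpret r: Vector_Spaces.linear "toroidal_scale scaleG" "toroidal_scale scaleG" "tbracket z"
    for z :: "('a, 'n) toroidal" by (rule tbracket_linear_right)
  note lin = l.add r.add l.neg r.neg l.zero r.zero
  have add1: "?J (u + u') v w = ?J u v w + ?J u' v w" for u u' v w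
    by (simp add: lin)
  have rot: "?J u v w = ?J v w u" for u v w
    by (simp add: algebra_simps)
  have lll: "?J (loop_elt a x) (loop_elt b y) (loop_elt c z) = 0" for a b c x y z
  proof -
    let ?m = "a + (b + c)"
    have inv: "killing_form y (bracket z x) = killing_form x (bracket y z)"
      "killing_form z (bracket x y) = killing_form x (bracket y z)"
      by (metis killing_form_invariant killing_form_sym)+
    have m: "b + (c + a) = ?m" "c + (a + b) = ?m" by (simp_all add: algebra_simps)
    have "loop_elt ?m (bracket x (bracket y z)) + loop_elt ?m (bracket y (bracket z x))
        + loop_elt ?m (bracket z (bracket x y)) = (0 :: ('a, 'n) toroidal)"
      unfolding loop_elt_simps(1)[symmetric] jacobi by (simp add: loop_elt_simps)
    moreover have "center_elt a ?m + center_elt b ?m + center_elt c ?m = 0"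
      using center_elt_self[of ?m] by (simp add: center_elt_add add.assoc)
    then have "center_scale k (center_elt a ?m) + center_scale k (center_elt b ?m)
        + center_scale k (center_elt c ?m) = 0" for k
      unfolding center.scale_right_distrib[symmetric] by simp
    ultimately show ?thesis
      by (simp add: lin tbracket_simps m inv) (simp add: loop_elt_def zero_prod_def)
  qed
  have lld: "?J (0, 0, \<delta>) (loop_elt a x) (loop_elt b y) = 0" for \<delta> a b x y
  proof -
    have "loop_elt (a + b) (scaleG (pairing \<delta> (a + b)) (bracket x y))
      - loop_elt (a + b) (bracket x (scaleG (pairing \<delta> b) y))
      + loop_elt (b + a) (bracket y (scaleG (pairing \<delta> a) x)) = (0 :: ('a, 'n) toroidal)"
      using bracket_antisym[of x y]
      by (simp add: loop_elt_simps[symmetric] add.commute[of b a] bracket_right.scale pairing_add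
          scale_left_distrib algebra_simps) (simp add: loop_elt_simps)
    moreover have "center_scale (pairing \<delta> (a + b)) (center_scale (killing_form x y) (center_elt a (a + b)))
      - center_scale (pairing \<delta> b * killing_form x y) (center_elt a (a + b))
      + center_scale (pairing \<delta> a * killing_form x y) (center_elt b (b + a)) = 0"
    proof -
      have "center_elt b (b + a) = - center_elt a (a + b)"
        using center_elt_swap[of b a] by (simp only: add.commute[of b a])
      then show ?thesis
        by (simp only: center.scale_scale pairing_add distrib_right center.scale_left_distrib
            center.scale_minus_right) simp
    qed
    ultimately show ?thesis
      using killing_form_sym[of y x]
      by (simp add: lin tbracket_simps killing_form_simps center_deriv.scale center_deriv_elt)
        (simp add: loop_elt_def zero_prod_def algebra_simps)
  qed
  have ldd: "?J (loop_elt a x) (0, 0, \<delta>) (0, 0, \<epsilon>) = 0" for \<delta> \<epsilon> a x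
    by (simp add: lin tbracket_simps loop_elt_simps mult.commute)
  have cdd: "?J (0, k, 0) (0, 0, \<delta>) (0, 0, \<epsilon>) = 0" for \<delta> \<epsilon> k
    using center_deriv_left(4)[of \<delta> \<epsilon> k]
    by (simp add: lin tbracket_simps zero_prod_def center_deriv.neg)
  have add2: "?J u (v + v') w = ?J u v w + ?J u v' w" "?J u v (w + w') = ?J u v w + ?J u v w'" for u v v' w w'
    by (simp_all add: lin)
  show ?thesis
  proof (induction u rule: toroidal_induct)
    case (add u u')
    then show ?case unfolding add1 by simp
  next
    case (loop a x)
    show ?case
    proof (induction v rule: toroidal_induct)
      case (add v v')
      then show ?case unfolding add2(1) by simp
    next
      case (loop b y)
      show ?case
      proof (induction w rule: toroidal_induct)
        case (add w w')
        then show ?case unfolding add2(2) by simp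
      next
        case (loop c z)
        show ?case by (rule lll)
      next
        case (degree \<delta>)
        show ?case using lld rot by simp
      qed (simp add: lin tbracket_simps)
    next
      case (central k)
      show ?case
      proof (induction w rule: toroidal_induct)
        case (add w w')
        then show ?case unfolding add2(2) by simp
      qed (simp_all add: lin tbracket_simps)
    next
      case (degree \<delta>)
      show ?case
      proof (induction w rule: toroidal_induct)
        case (add w w')
        then show ?case unfolding add2(2) by simp
      next
        case (loop c z)
        show ?case using lld rot by metis
      next
        case (degree \<epsilon>)
        show ?case by (rule ldd)
      qed (simp add: lin tbracket_simps)
    qed
  next
    case (central k)
    show ?case
    proof (induction v rule: toroidal_induct)
      case (add v v')
      then show ?case unfolding add2(1) by simp
    next
      case (degree \<delta>)
      show ?case
      proof (induction w rule: toroidal_induct)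
        case (add w w')
        then show ?case unfolding add2(2) by simp
      next
        case (degree \<epsilon>)
        show ?case by (rule cdd)
      qed (simp_all add: lin tbracket_simps)
    next
      case (loop b y)
      show ?case
      proof (induction w rule: toroidal_induct)
        case (add w w')
        then show ?case unfolding add2(2) by simp
      qed (simp_all add: lin tbracket_simps)
    next
      case (central l)
      show ?case
      proof (induction w rule: toroidal_induct)
        case (add w w')
        then show ?case unfolding add2(2) by simp
      qed (simp_all add: lin tbracket_simps)
    qed
  next
    case (degree \<delta>)
    show ?case
    proof (induction v rule: toroidal_induct)
      case (add v v')
      then show ?case unfolding add2(1) by simp
    next
      case (loop b y)
      show ?case
      proof (induction w rule: toroidal_induct)
        case (add w w')
        then show ?case unfolding add2(2) by simp
      next
        case (loop c z)
        show ?case by (rule lld)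
      next
        case (degree \<epsilon>)
        show ?case using ldd rot by metis
      qed (simp add: lin tbracket_simps)
    next
      case (central l)
      show ?case
      proof (induction w rule: toroidal_induct)
        case (add w w')
        then show ?case unfolding add2(2) by simp
      next
        case (degree \<epsilon>)
        show ?case using cdd rot by metis
      qed (simp_all add: lin tbracket_simps)
    next
      case (degree \<epsilon>)
      show ?case
      proof (induction w rule: toroidal_induct)
        case (add w w')
        then show ?case unfolding add2(2) by simp
      next
        case (loop c z)
        show ?case using ldd rot by metis
      next
        case (central l)
        show ?case using cdd rot by metis
      qed (simp add: lin tbracket_simps)
    qed
  qed
qed

theorem toroidal_lie_algebra: "lie_algebra (toroidal_scale scaleG) tbracket"
  by (intro lie_algebra.intro vector_space_toroidal lie_algebra_axioms.intro
      tbracket_linear_left tbracket_linear_right tbracket_alternating tbracket_jacobi)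

end

subsection \<open>Existence and uniqueness of the toroidal module structure\<close>

definition embed_d :: "'n mpoly \<Rightarrow> ('i + 'n) mpoly" where
  "embed_d = subst (\<lambda>j. Var (Inr j))"

lemma embed_d_hom:
  "embed_d (p + q) = embed_d p + embed_d q" "embed_d (p * q) = embed_d p * embed_d q"
  "embed_d (Const b) = Const b" "embed_d (Var i) = Var (Inr i)" "embed_d 0 = 0"
  "embed_d (p - q) = embed_d p - embed_d q" "embed_d (sum f A) = (\<Sum>a\<in>A. embed_d (f a))"
  by (simp_all add: embed_d_def subst_add subst_mult subst_diff subst_sum)

lemma embed_01 [simp]: "embed_h 0 = 0" "embed_h 1 = 1" "embed_d 1 = 1"
  by (simp_all add: embed_h_def embed_d_def)

lemma Var_power: "Var v ^ n = Poly_Mapping.single (Poly_Mapping.single v n) 1"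
  by (induction n) (simp_all add: Var_def mult_single single_add[symmetric])

lemma prod_Var_power:
  "finite A \<Longrightarrow> (\<Prod>v\<in>A. Var (g v) ^ e v)
     = Poly_Mapping.single (\<Sum>v\<in>A. Poly_Mapping.single (g v) (e v)) 1"
  by (induction A rule: finite_induct) (simp_all add: Var_power mult_single)

definition join_exp :: "('i \<Rightarrow>\<^sub>0 nat) \<Rightarrow> ('n \<Rightarrow>\<^sub>0 nat) \<Rightarrow> ('i + 'n \<Rightarrow>\<^sub>0 nat)" where
  "join_exp m k = (\<Sum>v\<in>Poly_Mapping.keys m. Poly_Mapping.single (Inl v) (Poly_Mapping.lookup m v)) +
     (\<Sum>v\<in>Poly_Mapping.keys k. Poly_Mapping.single (Inr v) (Poly_Mapping.lookup k v))"

lemma lookup_join_exp: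
  "Poly_Mapping.lookup (join_exp m k) (Inl i) = Poly_Mapping.lookup m i"
  "Poly_Mapping.lookup (join_exp m k) (Inr j) = Poly_Mapping.lookup k j"
  by (simp_all add: join_exp_def lookup_add lookup_sum lookup_single when_def in_keys_iff)

lemma embed_monomials:
  "embed_h (Poly_Mapping.single m 1) * embed_d (Poly_Mapping.single k 1)
     = Poly_Mapping.single (join_exp m k) 1"
  by (simp add: embed_h_def embed_d_def subst_single mono_eval_def prod_Var_power mult_single join_exp_def)

definition exp_left :: "('i + 'n \<Rightarrow>\<^sub>0 nat) \<Rightarrow> ('i \<Rightarrow>\<^sub>0 nat)" where
  "exp_left m = Poly_Mapping.map_key Inl m"

definition exp_right :: "('i + 'n \<Rightarrow>\<^sub>0 nat) \<Rightarrow> ('n \<Rightarrow>\<^sub>0 nat)" where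
  "exp_right m = Poly_Mapping.map_key Inr m"

lemma lookup_exp:
  "Poly_Mapping.lookup (exp_left m) i = Poly_Mapping.lookup m (Inl i)"
  "Poly_Mapping.lookup (exp_right m) j = Poly_Mapping.lookup m (Inr j)"
  by (simp_all add: exp_left_def exp_right_def map_key.rep_eq)

lemma join_exp_inverse:
  "join_exp (exp_left m) (exp_right m) = m" "exp_left (join_exp n k) = n" "exp_right (join_exp n k) = k"
proof -
  have "Poly_Mapping.lookup (join_exp (exp_left m) (exp_right m)) v = Poly_Mapping.lookup m v" for v
    by (cases v) (simp_all add: lookup_join_exp lookup_exp)
  then show "join_exp (exp_left m) (exp_right m) = m"
    by (simp add: poly_mapping_eq_iff fun_eq_iff)
  show "exp_left (join_exp n k) = n" "exp_right (join_exp n k) = k"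
    by (simp_all add: poly_mapping_eq_iff fun_eq_iff lookup_join_exp lookup_exp)
qed

lemma single_as_Const: "Poly_Mapping.single m c = Const c * Poly_Mapping.single m 1"
  for m :: "'a::comm_monoid_add"
  by (simp add: Const_def mult_single)

lemma mpoly_tensor_induct [case_names pure add]:
  fixes g :: "('i + 'n) mpoly"
  assumes pure: "\<And>f q. P (embed_h f * embed_d q)" and add: "\<And>p q. P p \<Longrightarrow> P q \<Longrightarrow> P (p + q)"
  shows "P g"
proof (induction g rule: poly_mapping_additive_induct)
  case zero
  show ?case using pure[of 0 0] by simp
next
  case (single m c)
  have "Poly_Mapping.single m c = Const c * Poly_Mapping.single m 1"
    by (rule single_as_Const)
  also have "\<dots> = embed_h (Const c * Poly_Mapping.single (exp_left m) 1)
      * embed_d (Poly_Mapping.single (exp_right m) 1)"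
    by (simp only: embed_h_hom mult.assoc embed_monomials join_exp_inverse)
  finally have "Poly_Mapping.single m c
      = embed_h (Const c * Poly_Mapping.single (exp_left m) 1) * embed_d (Poly_Mapping.single (exp_right m) 1)" .
  then show ?case using pure by metis
qed (rule add)

text \<open>\<open>tensor_id L\<close> is the operator \<open>L \<otimes> id\<close> on \<open>U(\<hh> \<oplus> D) = U(\<hh>) \<otimes> U(D)\<close>.\<close>

definition tensor_id :: "('i mpoly \<Rightarrow> 'i mpoly) \<Rightarrow> ('i + 'n) mpoly \<Rightarrow> ('i + 'n) mpoly" where
  "tensor_id L g = (\<Sum>m\<in>Poly_Mapping.keys g. Const (Poly_Mapping.lookup g m) *
     (embed_h (L (Poly_Mapping.single (exp_left m) 1)) * embed_d (Poly_Mapping.single (exp_right m) 1)))"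

lemma tensor_id_add: "tensor_id L (p + q) = tensor_id L p + tensor_id L q"
  unfolding tensor_id_def
  by (rule setsum_keys_plus_distrib) (simp_all add: algebra_simps)

lemma tensor_id_single:
  "tensor_id L (Poly_Mapping.single m c) = Const c *
     (embed_h (L (Poly_Mapping.single (exp_left m) 1)) * embed_d (Poly_Mapping.single (exp_right m) 1))"
  by (simp add: tensor_id_def)

lemma tensor_id_diff: "tensor_id L (p - q) = tensor_id L p - tensor_id L q"
  using tensor_id_add[of L "p - q" q] by simp

lemma tensor_id_zero [simp]: "tensor_id L 0 = 0"
  by (simp add: tensor_id_def)

abbreviation poly_linear :: "('i mpoly \<Rightarrow> 'i mpoly) \<Rightarrow> bool" where
  "poly_linear \<equiv> Vector_Spaces.linear poly_scale poly_scale"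

lemma tensor_id_pure:
  assumes "poly_linear L"
  shows "tensor_id L (embed_h f * embed_d q) = embed_h (L f) * embed_d q"
proof -
  interpret L: Vector_Spaces.linear poly_scale poly_scale L by fact
  show ?thesis
  proof (induction f rule: poly_mapping_additive_induct)
    case (single m c)
    have Lc: "L (Poly_Mapping.single m c) = Const c * L (Poly_Mapping.single m 1)"
      using L.scale[of c "Poly_Mapping.single m 1"] by (simp add: poly_scale_def flip: single_as_Const)
    show ?case
    proof (induction q rule: poly_mapping_additive_induct)
      case (single k d)
      have "embed_h (Poly_Mapping.single m c) * embed_d (Poly_Mapping.single k d)
          = Const (c * d) * (embed_h (Poly_Mapping.single m 1) * embed_d (Poly_Mapping.single k 1))"
        by (subst single_as_Const[of m c], subst single_as_Const[of k d])
           (simp add: embed_h_hom embed_d_hom Const_mult algebra_simps)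
      also have "\<dots> = Poly_Mapping.single (join_exp m k) (c * d)"
        by (simp add: embed_monomials flip: single_as_Const)
      finally have "tensor_id L (embed_h (Poly_Mapping.single m c) * embed_d (Poly_Mapping.single k d))
          = Const (c * d) * (embed_h (L (Poly_Mapping.single m 1)) * embed_d (Poly_Mapping.single k 1))"
        by (simp add: tensor_id_single join_exp_inverse)
      then show ?case
        by (subst single_as_Const[of k d]) (simp add: Lc embed_h_hom embed_d_hom Const_mult algebra_simps)
    qed (simp_all add: embed_d_hom distrib_left tensor_id_add)
  qed (simp_all add: embed_h_hom distrib_right tensor_id_add L.zero L.add)
qed

lemma tensor_id_Const:
  assumes "poly_linear L"
  shows "tensor_id L (Const c * g) = Const c * tensor_id L g"
proof (induction g rule: mpoly_tensor_induct)
  case (pure f q)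
  have eq: "Const c * (embed_h f * embed_d q) = embed_h f * embed_d (Const c * q)"
    by (simp add: embed_d_hom algebra_simps)
  show ?case unfolding eq tensor_id_pure[OF assms] by (simp add: embed_d_hom algebra_simps)
qed (simp add: distrib_left tensor_id_add)

lemma tensor_id_mult_d:
  assumes "poly_linear L"
  shows "tensor_id L (embed_d p * g) = embed_d p * tensor_id L g"
proof (induction g rule: mpoly_tensor_induct)
  case (pure f q)
  have eq: "embed_d p * (embed_h f * embed_d q) = embed_h f * embed_d (p * q)"
    by (simp add: embed_d_hom algebra_simps)
  show ?case unfolding eq tensor_id_pure[OF assms] by (simp add: embed_d_hom algebra_simps)
qed (simp add: distrib_left tensor_id_add)

lemma tensor_id_comp:
  assumes "poly_linear L" "poly_linear M"
  shows "tensor_id L (tensor_id M g) = tensor_id (\<lambda>f. L (M f)) g"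
proof (induction g rule: mpoly_tensor_induct)
  case (pure f q)
  have "poly_linear (\<lambda>f. L (M f))"
    using Vector_Spaces.linear_compose[OF assms(2,1)] by (simp add: comp_def)
  then show ?case by (simp add: tensor_id_pure assms)
qed (simp add: tensor_id_add)

lemma tensor_id_left:
  "tensor_id (\<lambda>f. L f + M f) g = tensor_id L g + tensor_id M g"
  "tensor_id (\<lambda>f. L f - M f) g = tensor_id L g - tensor_id M g"
  "tensor_id (\<lambda>f. Const c * L f) g = Const c * tensor_id L g"
  "tensor_id (\<lambda>f. 0) g = 0"
  by (simp_all add: tensor_id_def embed_h_hom algebra_simps sum.distrib sum_subtractf sum_distrib_left)

lemma tau_embed: "tau a (embed_h f) = embed_h f"
  by (induction f rule: mpoly_induct) (simp_all add: embed_h_hom tau_hom)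

lemma tau_embed_d: "tau a (embed_d q) = embed_d (shift (\<lambda>j. of_int (a $ j)) q)"
  by (induction q rule: mpoly_induct) (simp_all add: embed_d_hom tau_hom shift_hom)

lemma tau_tensor_id:
  assumes "poly_linear L"
  shows "tau a (tensor_id L g) = tensor_id L (tau a g)"
proof (induction g rule: mpoly_tensor_induct)
  case (pure f q)
  show ?case by (simp add: tensor_id_pure[OF assms] tau_hom tau_embed tau_embed_d)
qed (simp add: tensor_id_add tau_hom)

lemma tensor_id_shift:
  fixes g :: "('i + 'n) mpoly"
  assumes L: "poly_linear L" and eq: "\<And>f. L f = shift c f * v"
  shows "tensor_id L g = shift (case_sum c (\<lambda>_. 0)) g * embed_h v"
proof (induction g rule: mpoly_tensor_induct)
  case (pure f q)
  have "shift (case_sum c (\<lambda>_. 0)) (embed_h f :: ('i + 'n) mpoly) = embed_h (shift c f)" for f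
    by (induction f rule: mpoly_induct) (simp_all add: embed_h_hom shift_hom)
  moreover have "shift (case_sum c (\<lambda>_. 0)) (embed_d q :: ('i + 'n) mpoly) = embed_d q" for q
    by (induction q rule: mpoly_induct) (simp_all add: embed_d_hom shift_hom)
  ultimately show ?case
    unfolding tensor_id_pure[OF L] eq[of f] by (simp add: shift_hom embed_h_hom algebra_simps)
qed (simp add: tensor_id_add shift_hom distrib_right)

lemma sigma_alt: "sigma i = shift (case_sum (\<lambda>j. if j = i then 1 else 0) (\<lambda>_. 0))"
  and inv_sigma_alt: "inv (sigma i) = shift (case_sum (\<lambda>j. if j = i then - 1 else 0) (\<lambda>_. 0))"
  unfolding sigma_def inv_shift
  by (rule arg_cong[of _ _ shift]; auto simp: fun_eq_iff split: sum.split)+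

lemma lambda_power_add:
  assumes "\<forall>j. lam $ j \<noteq> 0"
  shows "lambda_power lam (a + b) = lambda_power lam a * lambda_power lam b"
  using assms by (simp add: lambda_power_def power_int_add prod.distrib)

lemma shift_twist:
  assumes mod: "lie_module scaleG bracket poly_scale act"
    and H: "\<And>j f. act (H j) f = Var j * f"
    and br: "\<And>j. bracket (H j) z = scaleG (c j) z"
  shows "act z f = shift c f * act z 1"
proof -
  interpret lie_module scaleG bracket poly_scale act by fact
  interpret right: Vector_Spaces.linear poly_scale poly_scale "act w" for w by (rule act_linear_right)
  interpret left: Vector_Spaces.linear scaleG poly_scale "\<lambda>w. act w q" for q by (rule act_linear_left)
  show ?thesis
  proof (induction f rule: mpoly_induct)
    case (const b)
    show ?case using right.scale[of z b 1] by (simp add: poly_scale_def shift_hom)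
  next
    case (add p q)
    then show ?case by (simp add: right.add shift_hom distrib_right)
  next
    case (var v p)
    have "Const (c v) * act z p = Var v * act z p - act z (Var v * p)"
      using act_bracket[of "H v" z p] by (simp add: br left.scale H poly_scale_def)
    with var show ?case by (simp add: shift_hom algebra_simps)
  qed
qed

definition deg_poly :: "complex ^ 'n::finite \<Rightarrow> 'n mpoly" where
  "deg_poly \<delta> = (\<Sum>j\<in>UNIV. Const (\<delta> $ j) * Var j)"

lemma tau_deg_poly:
  fixes a :: "int ^ 'n::finite"
  shows "tau a (embed_d (deg_poly \<delta>) :: ('i + 'n) mpoly) = embed_d (deg_poly \<delta>) - Const (pairing \<delta> a)"
proof -
  have tau_sum: "tau a (sum f A) = (\<Sum>x\<in>A. tau a (f x))" for f :: "'x \<Rightarrow> ('i + 'n) mpoly" and A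
    by (induction A rule: infinite_finite_induct) (use tau_hom(3)[of a 0] in \<open>simp_all add: tau_hom\<close>)
  have Const_sum: "Const (sum f A) = (\<Sum>x\<in>A. Const (f x) :: ('i + 'n) mpoly)" for f :: "'x \<Rightarrow> complex" and A
    by (induction A rule: infinite_finite_induct) simp_all
  show ?thesis
    by (simp add: deg_poly_def embed_d_hom tau_sum tau_hom pairing_def Const_sum algebra_simps
        Const_mult sum_subtractf)
qed

definition toroidal_act ::
    "complex ^ 'n::finite \<Rightarrow> ('g::ab_group_add \<Rightarrow> 'i mpoly \<Rightarrow> 'i mpoly) \<Rightarrow>
     ('g, 'n) toroidal \<Rightarrow> ('i + 'n) mpoly \<Rightarrow> ('i + 'n) mpoly" where
  "toroidal_act lam act = (\<lambda>(P, k, \<delta>) g.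
     (\<Sum>a\<in>Poly_Mapping.keys P. Const (lambda_power lam a) * tensor_id (act (Poly_Mapping.lookup P a)) (tau a g))
     + embed_d (deg_poly \<delta>) * g)"

context
  fixes scaleG :: "complex \<Rightarrow> 'g::ab_group_add \<Rightarrow> 'g" and bracket :: "'g \<Rightarrow> 'g \<Rightarrow> 'g"
    and act :: "'g \<Rightarrow> 'i::finite mpoly \<Rightarrow> 'i mpoly" and lam :: "complex ^ 'n::finite"
  assumes simple_g: "simple_lie_algebra scaleG bracket"
    and module_g: "lie_module scaleG bracket poly_scale act"
    and lam: "\<forall>j. lam $ j \<noteq> 0"
begin

interpretation simple_lie_algebra scaleG bracket by (rule simple_g)
interpretation lie_module scaleG bracket poly_scale act by (rule module_g)
interpretation right: Vector_Spaces.linear poly_scale poly_scale "act z" for z by (rule act_linear_right)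
interpretation left: Vector_Spaces.linear scaleG poly_scale "\<lambda>z. act z f" for f by (rule act_linear_left)

lemma act_left:
  "act (x + y) = (\<lambda>f. act x f + act y f)" "act (scaleG c x) = (\<lambda>f. Const c * act x f)" "act 0 = (\<lambda>f. 0)"
  "act (bracket x y) = (\<lambda>f. act x (act y f) - act y (act x f))"
  by (simp_all add: fun_eq_iff left.add left.scale left.zero poly_scale_def act_bracket)

abbreviation TA :: "('g, 'n) toroidal \<Rightarrow> ('i + 'n) mpoly \<Rightarrow> ('i + 'n) mpoly" where
  "TA \<equiv> toroidal_act lam act"

lemma TA_loop: "TA (loop_elt a x) g = Const (lambda_power lam a) * tensor_id (act x) (tau a g)"
  by (simp add: toroidal_act_def loop_elt_def deg_poly_def embed_d_hom act_left tensor_id_left)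

lemma TA_central: "TA (0, k, 0) g = 0"
  by (simp add: toroidal_act_def deg_poly_def embed_d_hom)

lemma TA_degree: "TA (0, 0, \<delta>) g = embed_d (deg_poly \<delta>) * g"
  by (simp add: toroidal_act_def)

lemma TA_add_left: "TA (u + v) g = TA u g + TA v g"
proof -
  have "(\<Sum>a\<in>Poly_Mapping.keys (P + Q). Const (lambda_power lam a) * tensor_id (act (Poly_Mapping.lookup (P + Q) a)) (tau a g))
     = (\<Sum>a\<in>Poly_Mapping.keys P. Const (lambda_power lam a) * tensor_id (act (Poly_Mapping.lookup P a)) (tau a g))
     + (\<Sum>a\<in>Poly_Mapping.keys Q. Const (lambda_power lam a) * tensor_id (act (Poly_Mapping.lookup Q a)) (tau a g))"
    for P Q :: "(int ^ 'n) \<Rightarrow>\<^sub>0 'g"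
    by (rule setsum_keys_plus_distrib) (simp_all add: act_left tensor_id_left algebra_simps)
  then show ?thesis
    by (auto simp: toroidal_act_def deg_poly_def embed_d_hom distrib_right sum.distrib split: prod.split)
qed

lemma TA_right: "TA u (p + q) = TA u p + TA u q" "TA u (Const c * p) = Const c * TA u p"
  by (auto simp: toroidal_act_def tensor_id_add tau_hom distrib_left sum.distrib tensor_id_Const
      act_linear_right sum_distrib_left algebra_simps split: prod.split)

lemma TA_scale_left: "TA (toroidal_scale scaleG c u) g = Const c * TA u g"
proof (induction u rule: toroidal_induct)
  case (add u v)
  interpret T: vector_space "toroidal_scale scaleG :: complex \<Rightarrow> ('g, 'n) toroidal \<Rightarrow> _"
    by (rule vector_space_toroidal)
  show ?case using add by (simp add: T.scale_right_distrib TA_add_left distrib_left)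
next
  case (loop a x)
  have "toroidal_scale scaleG c (loop_elt a x :: ('g, 'n) toroidal) = loop_elt a (scaleG c x)"
    by (simp add: toroidal_scale_def loop_elt_def loop_scale_simps)
  then show ?case by (simp add: TA_loop act_left tensor_id_left algebra_simps)
next
  case (central k)
  then show ?case by (simp add: toroidal_scale_def loop_scale_simps TA_central)
next
  case (degree \<delta>)
  have "deg_poly (c *s \<delta>) = Const c * deg_poly \<delta>"
    by (simp add: deg_poly_def sum_distrib_left Const_mult mult.assoc)
  then show ?case
    by (simp add: toroidal_scale_def loop_scale_simps TA_degree embed_d_hom mult.assoc)
qed

lemma TA_neg: "TA (- u) g = - TA u g"
  using TA_add_left[of u "- u" g] TA_central[of 0 g]
  by (simp add: eq_neg_iff_add_eq_0 add.commute flip: zero_prod_def)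

lemma TA_bracket: "TA (tbracket u v) g = TA u (TA v g) - TA v (TA u g)"
proof -
  interpret l: Vector_Spaces.linear "toroidal_scale scaleG" "toroidal_scale scaleG" "\<lambda>u. tbracket u z"
    for z :: "('g, 'n) toroidal" by (rule tbracket_linear_left)
  interpret r: Vector_Spaces.linear "toroidal_scale scaleG" "toroidal_scale scaleG" "tbracket z"
    for z :: "('g, 'n) toroidal" by (rule tbracket_linear_right)
  note lin = l.add r.add TA_add_left TA_right TA_neg
  have TA_zero: "TA 0 g = 0" "TA u 0 = 0" for u g
    using TA_central[of 0 g] TA_right(2)[of u 0 0] by (simp_all flip: zero_prod_def)
  have ld: "TA (loop_elt a (scaleG (pairing \<delta> a) x)) g
      = TA (0, 0, \<delta>) (TA (loop_elt a x) g) - TA (loop_elt a x) (TA (0, 0, \<delta>) g)" for a \<delta> x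
  proof -
    have eq: "tensor_id (act x) ((embed_d (deg_poly \<delta>) - Const (pairing \<delta> a)) * tau a g)
        = embed_d (deg_poly \<delta>) * tensor_id (act x) (tau a g)
          - Const (pairing \<delta> a) * tensor_id (act x) (tau a g)"
      by (simp only: left_diff_distrib tensor_id_diff tensor_id_mult_d[OF act_linear_right]
          tensor_id_Const[OF act_linear_right])
    show ?thesis
      unfolding TA_loop TA_degree tau_hom tau_deg_poly eq act_left tensor_id_left
      by (simp add: algebra_simps)
  qed
  show ?thesis
  proof (induction u rule: toroidal_induct)
    case (loop a x)
    show ?case
    proof (induction v rule: toroidal_induct)
      case (loop b y)
      show ?case
        by (simp add: tbracket_simps lin TA_central)
           (simp add: TA_loop act_left tensor_id_left tau_hom tau_tensor_id tensor_id_Const act_linear_right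
             tensor_id_comp lambda_power_add[OF lam] Const_mult tau_add[symmetric] add.commute,
             simp add: algebra_simps)
    next
      case (degree \<delta>)
      show ?case using ld by (simp add: tbracket_simps lin)
    qed (simp_all add: lin tbracket_simps TA_central TA_zero)
  next
    case (degree \<delta>)
    show ?case
    proof (induction v rule: toroidal_induct)
      case (loop b y)
      show ?case using ld by (simp add: tbracket_simps)
    qed (simp_all add: lin tbracket_simps TA_central TA_zero TA_degree algebra_simps)
  next
    case (central k)
    show ?case
      by (induction v rule: toroidal_induct) (simp_all add: lin tbracket_simps TA_central TA_zero)
  qed (simp add: lin)
qed

lemma TA_module: "lie_module (toroidal_scale scaleG) tbracket poly_scale TA"
proof -
  interpret T: lie_algebra "toroidal_scale scaleG :: _ \<Rightarrow> ('g, 'n) toroidal \<Rightarrow> _" tbracket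
    by (rule toroidal_lie_algebra)
  show ?thesis
    by unfold_locales (simp_all add: TA_add_left TA_right TA_scale_left TA_bracket poly_scale_def)
qed

end

context simple_lie_algebra
begin

theorem toroidal_module_exists:
  fixes lam :: "complex ^ 'n::finite" and x y H :: "'i::finite \<Rightarrow> 'a"
  assumes H: "root_dual_basis \<hh> x y H" and lam: "\<forall>j. lam $ j \<noteq> 0"
    and obj: "free_rank_one_object scaleG bracket H act"
  shows "toroidal_module scaleG bracket x y H lam act (toroidal_act lam act)"
proof -
  have simple: "simple_lie_algebra scaleG bracket" by unfold_locales
  interpret lie_module scaleG bracket poly_scale act
    using obj by (simp add: free_rank_one_object_def)
  note module = lie_module_axioms
  note ctx = simple module lam
  have act_H: "act (\<Sum>i\<in>UNIV. scaleG (c i) (H i)) f = (\<Sum>i\<in>UNIV. Const (c i) * Var i) * f" for c f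
    using obj by (simp add: free_rank_one_object_def)
  have H_i: "act (H i) f = Var i * f" for i f
  proof -
    have "(\<Sum>k\<in>UNIV. scaleG (if k = i then 1 else 0) (H k)) = H i"
      by (subst sum.remove[of _ i]) auto
    moreover have "(\<Sum>k\<in>UNIV. Const (if k = i then 1 else 0) * Var k) = Var i"
      by (subst sum.remove[of _ i]) auto
    ultimately show ?thesis using act_H by metis
  qed
  have x_i: "act (x i) f = shift (\<lambda>j. if j = i then 1 else 0) f * act (x i) 1"
    and y_i: "act (y i) f = shift (\<lambda>j. if j = i then - 1 else 0) f * act (y i) 1" for i f
    using H by (intro shift_twist[OF module H_i]; auto simp: root_dual_basis_def)+
  have Hpoly: "tensor_id (act (\<Sum>i\<in>UNIV. scaleG (c i) (H i))) g
      = embed_h (\<Sum>i\<in>UNIV. Const (c i) * Var i) * g" for c and g :: "('i + 'n) mpoly"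
  proof -
    have "tensor_id (act (\<Sum>i\<in>UNIV. scaleG (c i) (H i))) g
        = shift (case_sum (\<lambda>_. 0) (\<lambda>_. 0)) g * embed_h (\<Sum>i\<in>UNIV. Const (c i) * Var i)"
      by (rule tensor_id_shift) (simp_all add: act_linear_right act_H mult.commute)
    moreover have "case_sum (\<lambda>_. 0) (\<lambda>_. 0) = (\<lambda>_ :: 'i + 'n. 0 :: complex)"
      by (auto simp: fun_eq_iff split: sum.split)
    ultimately show ?thesis by (simp add: mult.commute)
  qed
  have deg: "deg_poly (axis j 1) = Var j" for j :: 'n
    unfolding deg_poly_def by (subst sum.remove[of _ j]) (auto simp: axis_def)
  show ?thesis
    unfolding toroidal_module_def inv_sigma_alt
    using TA_module[OF ctx]
    by (simp add: TA_loop[OF ctx] Hpoly central_elt_def TA_central[OF ctx] degree_elt_def TA_degree[OF ctx]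
        deg embed_d_hom tensor_id_shift[OF act_linear_right x_i] tensor_id_shift[OF act_linear_right y_i]
        sigma_alt mult.assoc)
qed

theorem toroidal_module_unique:
  fixes lam :: "complex ^ 'n::finite" and x y H :: "'i::finite \<Rightarrow> 'a"
  assumes gen: "chevalley_generators \<hh> x y h"
    and ext: "toroidal_module scaleG bracket x y H lam act actT"
      "toroidal_module scaleG bracket x y H lam act actT'"
  shows "actT = actT'"
proof -
  interpret M: lie_module "toroidal_scale scaleG" "tbracket :: ('a, 'n) toroidal \<Rightarrow> _" poly_scale actT
    using ext(1) by (simp add: toroidal_module_def)
  interpret M': lie_module "toroidal_scale scaleG" "tbracket :: ('a, 'n) toroidal \<Rightarrow> _" poly_scale actT'
    using ext(2) by (simp add: toroidal_module_def)
  interpret l: Vector_Spaces.linear "toroidal_scale scaleG" poly_scale "\<lambda>u. actT u q" for q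
    by (rule M.act_linear_left)
  interpret l': Vector_Spaces.linear "toroidal_scale scaleG" poly_scale "\<lambda>u. actT' u q" for q
    by (rule M'.act_linear_left)
  have central_zero: "B (0, k, 0) g = 0"
    if B: "toroidal_module scaleG bracket x y H lam act B" for B k g
  proof -
    interpret B: lie_module "toroidal_scale scaleG" "tbracket :: ('a, 'n) toroidal \<Rightarrow> _" poly_scale B
      using B by (simp add: toroidal_module_def)
    interpret Bl: Vector_Spaces.linear "toroidal_scale scaleG" poly_scale "\<lambda>u. B u q" for q
      by (rule B.act_linear_left)
    have cadd: "B (0, k + k', 0) g = B (0, k, 0) g + B (0, k', 0) g" for k k'
      using Bl.add[of "(0, k, 0)" "(0, k', 0)"] by simp
    have czero: "B (0, 0, 0) g = 0"
      using Bl.zero by (simp add: zero_prod_def)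
    have ax: "B (0, abs_center (axis j p), 0) g = 0" for j p
    proof (induction p rule: poly_mapping_additive_induct)
      case zero
      have ax0: "axis j 0 = (0 :: 'n laurent ^ 'n)" by (simp add: vec_eq_iff axis_def)
      show ?case using czero unfolding ax0 zero_center_def .
    next
      case (single a c)
      have "axis j (Poly_Mapping.single a c) = omega_scale c (tpow a *s axis j 1)"
        by (auto simp: vec_eq_iff axis_def omega_scale_def Const_def tpow_def mult_single)
      then have "B (0, abs_center (axis j (Poly_Mapping.single a c)), 0) g
          = B (toroidal_scale scaleG c (central_elt a j)) g"
        by (simp add: toroidal_scale_def central_elt_def center_scale.abs_eq loop_scale_simps)
      then show ?case
        using B by (simp add: Bl.scale toroidal_module_def)
    next
      case (add p q)
      have "axis j (p + q) = axis j p + axis j q" by (simp add: vec_eq_iff axis_def)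
      with add cadd show ?case by (simp flip: plus_center.abs_eq)
    qed
    have "\<exists>w. k = abs_center w" by (induction k rule: center.abs_induct) blast
    then obtain w where w: "k = abs_center w" by blast
    have "w = (\<Sum>j\<in>UNIV. axis j (w $ j))"
      by (simp add: vec_eq_iff axis_def)
    then have k: "k = (\<Sum>j\<in>UNIV. abs_center (axis j (w $ j)))"
      unfolding abs_center_sum[symmetric] using w by simp
    have "B (0, \<Sum>j\<in>A. abs_center (axis j (w $ j)), 0) g = 0" if "finite A" for A
      using that by induction (simp_all add: czero cadd ax)
    then show ?thesis by (simp add: k)
  qed
  have degree_eq: "B (0, 0, \<delta>) g = (\<Sum>j\<in>UNIV. Const (\<delta> $ j) * (Var (Inr j) * g))"
    if B: "toroidal_module scaleG bracket x y H lam act B" for B \<delta> g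
  proof -
    interpret B: lie_module "toroidal_scale scaleG" "tbracket :: ('a, 'n) toroidal \<Rightarrow> _" poly_scale B
      using B by (simp add: toroidal_module_def)
    interpret Bl: Vector_Spaces.linear "toroidal_scale scaleG" poly_scale "\<lambda>u. B u q" for q
      by (rule B.act_linear_left)
    have d: "(0, 0, \<Sum>j\<in>A. \<delta> $ j *s axis j 1) = (\<Sum>j\<in>A. toroidal_scale scaleG (\<delta> $ j) (degree_elt j :: ('a, 'n) toroidal))"
      if "finite A" for A
      using that
    proof induction
      case (insert j F)
      show ?case
        unfolding sum.insert[OF insert.hyps] insert.IH[symmetric]
        by (simp add: toroidal_scale_def degree_elt_def loop_scale_simps)
    qed (simp add: zero_prod_def)
    have sum: "(\<Sum>j\<in>UNIV. \<delta> $ j *s axis j 1) = \<delta>"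
      by (auto simp: vec_eq_iff axis_def if_distrib cong: if_cong)
    have "B (0, 0, \<delta>) g = B (\<Sum>j\<in>UNIV. toroidal_scale scaleG (\<delta> $ j) (degree_elt j)) g"
      using d[of UNIV] unfolding sum by simp
    then show ?thesis
      using B by (simp add: Bl.sum Bl.scale toroidal_module_def poly_scale_def)
  qed
  define S where "S = {z. \<forall>a :: int ^ 'n. actT (loop_elt a z) = actT' (loop_elt a z)}"
  have scale_loop: "loop_elt a (scaleG c z) = toroidal_scale scaleG c (loop_elt a z :: ('a, 'n) toroidal)" for a c z
    by (simp add: toroidal_scale_def loop_elt_def loop_scale_simps)
  have "subalgebra S"
    unfolding subalgebra_def subspace_def
  proof (intro conjI ballI allI)
    show "0 \<in> S" by (simp add: S_def fun_eq_iff loop_elt_simps l.zero l'.zero)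
    show "z + z' \<in> S" if "z \<in> S" "z' \<in> S" for z z'
      using that by (simp add: S_def fun_eq_iff loop_elt_simps l.add l'.add)
    show "scaleG c z \<in> S" if "z \<in> S" for c z
      using that by (simp add: S_def fun_eq_iff scale_loop l.scale l'.scale)
    show "bracket z z' \<in> S" if "z \<in> S" "z' \<in> S" for z z'
    proof -
      have "B (loop_elt a (bracket z z')) g = B (tbracket (loop_elt a z) (loop_elt 0 z')) g"
        if B: "toroidal_module scaleG bracket x y H lam act B" for B a g
      proof -
        interpret B: lie_module "toroidal_scale scaleG" "tbracket :: ('a, 'n) toroidal \<Rightarrow> _" poly_scale B
          using B by (simp add: toroidal_module_def)
        interpret Bl: Vector_Spaces.linear "toroidal_scale scaleG" poly_scale "\<lambda>u. B u q" for q
          by (rule B.act_linear_left)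
        show ?thesis by (simp add: tbracket_simps Bl.add central_zero[OF B])
      qed
      from this[OF ext(1)] this[OF ext(2)] that show ?thesis
        by (simp add: S_def fun_eq_iff M.act_bracket M'.act_bracket)
    qed
  qed
  moreover have "range x \<union> range y \<subseteq> S"
    using ext by (auto simp: S_def fun_eq_iff toroidal_module_def)
  ultimately have "S = UNIV"
    using gen by (auto simp: chevalley_generators_def generates_def)
  then have "z \<in> S" for z by simp
  then have loop_eq: "actT (loop_elt a z) g = actT' (loop_elt a z) g" for a z g
    by (simp add: S_def)
  have "actT u g = actT' u g" for u g
  proof (induction u rule: toroidal_induct)
    case (add u v)
    then show ?case by (simp add: l.add l'.add)
  next
    case (loop a z)
    show ?case by (rule loop_eq)
  next
    case (central k)
    show ?case using ext by (simp add: central_zero)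
  next
    case (degree \<delta>)
    show ?case using ext by (simp add: degree_eq)
  qed
  then show ?thesis by (simp add: fun_eq_iff)
qed

theorem toroidal_module_ex1:
  fixes lam :: "complex ^ 'n::finite" and x y h H :: "'i::finite \<Rightarrow> 'a"
  assumes "chevalley_generators \<hh> x y h" "root_dual_basis \<hh> x y H" "\<forall>j. lam $ j \<noteq> 0"
    "free_rank_one_object scaleG bracket H act"
  shows "\<exists>!actT. toroidal_module scaleG bracket x y H lam act actT"
  using toroidal_module_exists[OF assms(2-4)] toroidal_module_unique[OF assms(1)] by blast

end

end

theory Submission
  imports Defs
begin

text \<open>
  Write the toroidal module as \<open>M \<otimes> U(D)\<close> with \<open>M = U(\<hh>)\<close>. By uniqueness of the module structure,
  \<open>x(a)\<close> acts as \<open>\<lambda>\<^sup>a\<close> times \<open>x \<otimes> \<tau>\<^sup>a\<close>, and \<open>d\<^sub>j\<close> as multiplication.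

  If \<open>W\<close> is a submodule of \<open>M\<close>, then \<open>W \<otimes> U(D)\<close> is stable under these operators. Setting all \<open>d\<^sub>j\<close> to
  \<open>0\<close> maps it back onto \<open>W\<close>, so it is zero or everything only if \<open>W\<close> is. Hence simplicity
  descends to \<open>M\<close> (\<open>simple_if_toroidal_simple\<close>).

  Conversely, let \<open>M\<close> be simple and \<open>W\<close> a nonzero submodule of \<open>M \<otimes> U(D)\<close>. Any \<open>H\<^sub>i\<close> acts on \<open>M\<close> by
  multiplication, which is injective, and comparing \<open>H\<^sub>i(a)\<close> with \<open>H\<^sub>i(0)\<close> shows that \<open>W\<close> is stable under
  \<open>g \<mapsto> H\<^sub>i (\<tau>\<^sup>a(g) - g)\<close>. A difference operator lowers the degree in \<open>d\<^sub>j\<close>; iterated as often as that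
  degree, it leaves a nonzero polynomial without \<open>d\<^sub>j\<close> (\<open>backward_diff_eliminates\<close>). Removing the
  \<open>d\<^sub>j\<close> one after another gives a nonzero \<open>f \<otimes> 1\<close> in \<open>W\<close>. The \<open>f\<close> with \<open>f \<otimes> 1 \<in> W\<close> form a
  submodule of \<open>M\<close>, so \<open>W\<close> contains \<open>M \<otimes> 1\<close>, and multiplication by the \<open>d\<^sub>j\<close> yields everything
  (\<open>toroidal_simple_if_simple\<close>).
\<close>

section \<open>Elimination of a variable by finite differences\<close>

text \<open>The absence of a variable is expressed by a substitution rather than by exponents, so that it
  inherits its closure properties from a ring homomorphism.\<close>

definition free_of :: "'v \<Rightarrow> 'v mpoly \<Rightarrow> bool" where
  "free_of u p \<longleftrightarrow> subst (Var(u := 0)) p = p"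

definition backward_diff :: "'v \<Rightarrow> 'v mpoly \<Rightarrow> 'v mpoly" where
  "backward_diff u p = shift (\<lambda>v. if v = u then 1 else 0) p - p"

lemma free_of_intros:
  "free_of u (Const c)" "free_of u 0" "v \<noteq> u \<Longrightarrow> free_of u (Var v)"
  "free_of u p \<Longrightarrow> free_of u q \<Longrightarrow> free_of u (p + q)"
  "free_of u p \<Longrightarrow> free_of u q \<Longrightarrow> free_of u (p - q)"
  "free_of u p \<Longrightarrow> free_of u q \<Longrightarrow> free_of u (p * q)"
  by (simp_all add: free_of_def subst_add subst_diff subst_mult)

lemma free_of_shift:
  assumes "free_of u p" and "c u = 0"
  shows "free_of u (shift c p)"
proof -
  have "subst (Var(u := 0)) (shift c q) = shift c (subst (Var(u := 0)) q)" for q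
    using \<open>c u = 0\<close>
    by (induction q rule: mpoly_induct) (auto simp: subst_add subst_mult subst_diff shift_hom shift_def)
  with assms(1) show ?thesis by (simp add: free_of_def)
qed

lemma free_of_backward_diff:
  "free_of w p \<Longrightarrow> w \<noteq> u \<Longrightarrow> free_of w (backward_diff u p)"
  unfolding backward_diff_def by (intro free_of_intros free_of_shift) auto

lemma shift_free_of:
  assumes "free_of u p" and "\<And>v. v \<noteq> u \<Longrightarrow> c v = 0"
  shows "shift c p = p"
proof -
  have "shift c (subst (Var(u := 0)) p) = subst (Var(u := 0)) p"
    by (induction p rule: mpoly_induct) (auto simp: assms(2) subst_add subst_mult shift_hom shift_def)
  with assms(1) show ?thesis by (simp add: free_of_def)
qed

lemma backward_diff_add: "backward_diff u (p + q) = backward_diff u p + backward_diff u q"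
  by (simp add: backward_diff_def shift_hom)

lemma backward_diff_mult:
  assumes "free_of u f"
  shows "backward_diff u (f * p) = f * backward_diff u p"
proof -
  have "shift (\<lambda>v. if v = u then 1 else 0) f = f"
    using assms by (rule shift_free_of) simp
  then show ?thesis by (simp add: backward_diff_def shift_hom algebra_simps)
qed

lemma backward_diff_funpow_add:
  "(backward_diff u ^^ k) (p + q) = (backward_diff u ^^ k) p + (backward_diff u ^^ k) q"
  by (induction k) (simp_all add: backward_diff_add)

lemma Const_of_nat: "Const (of_nat k) = (of_nat k :: 'a::comm_monoid_add \<Rightarrow>\<^sub>0 complex)"
  by (induction k) simp_all

text \<open>Rising factorials are to the backward difference what powers are to the derivative: the factors
  of \<open>X (X + 1) \<cdots> (X + k)\<close> and of its shift \<open>(X - 1) X \<cdots> (X + k - 1)\<close> agree except at the two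
  ends.\<close>

lemma backward_diff_pochhammer:
  "backward_diff u (pochhammer (Var u) (Suc k)) = Const (- of_nat (Suc k)) * pochhammer (Var u) k"
proof -
  let ?s = "shift (\<lambda>v. if v = u then 1 else 0)"
  have s: "?s (pochhammer (Var u) k) = pochhammer (Var u - 1) k" for k
  proof (induction k)
    case 0
    show ?case using shift_hom(3)[of _ 1] by simp
  next
    case (Suc k)
    have "?s (of_nat k) = of_nat k"
      unfolding Const_of_nat[symmetric] by (simp only: shift_hom)
    with Suc show ?case by (simp add: pochhammer_Suc shift_hom)
  qed
  have "pochhammer (Var u - 1) (Suc k) = (Var u - 1) * pochhammer (Var u) k"
    by (simp add: pochhammer_rec)
  then show ?thesis
    unfolding backward_diff_def s
    by (simp add: pochhammer_Suc Const_of_nat algebra_simps)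
qed

text \<open>These are the polynomials of degree less than \<open>N\<close> in the variable \<open>u\<close>. They are expanded in
  rising factorials rather than powers so that a difference of each basis element is a multiple of
  the preceding one.\<close>

primrec newton_space :: "'v \<Rightarrow> nat \<Rightarrow> 'v mpoly set" where
  "newton_space u 0 = {0}"
| "newton_space u (Suc N) =
     {f * pochhammer (Var u) N + q | f q. free_of u f \<and> q \<in> newton_space u N}"

lemma newton_space_SucI:
  "free_of u f \<Longrightarrow> q \<in> newton_space u N \<Longrightarrow> f * pochhammer (Var u) N + q \<in> newton_space u (Suc N)"
  by auto

lemma newton_space_Suc: "p \<in> newton_space u N \<Longrightarrow> p \<in> newton_space u (Suc N)"
  using newton_space_SucI[OF free_of_intros(2), of p u N] by simp

lemma newton_space_mono: "N \<le> M \<Longrightarrow> p \<in> newton_space u N \<Longrightarrow> p \<in> newton_space u M"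
  by (induction rule: dec_induct) (blast intro: newton_space_Suc)+

lemma newton_space_zero: "0 \<in> newton_space u N"
  by (induction N) (simp, rule newton_space_Suc)

lemma newton_space_add:
  "p \<in> newton_space u N \<Longrightarrow> q \<in> newton_space u N \<Longrightarrow> p + q \<in> newton_space u N"
proof (induction N arbitrary: p q)
  case (Suc N)
  then obtain f p' g q' where "free_of u f" "p' \<in> newton_space u N" "p = f * pochhammer (Var u) N + p'"
    "free_of u g" "q' \<in> newton_space u N" "q = g * pochhammer (Var u) N + q'"
    by auto
  with Suc.IH newton_space_SucI[of u "f + g" "p' + q'" N] show ?case
    by (simp add: free_of_intros algebra_simps del: newton_space.simps)
qed simp

lemma newton_space_mult:
  "free_of u f \<Longrightarrow> p \<in> newton_space u N \<Longrightarrow> f * p \<in> newton_space u N"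
proof (induction N arbitrary: p)
  case (Suc N)
  then obtain g q where "free_of u g" "q \<in> newton_space u N" "p = g * pochhammer (Var u) N + q"
    by auto
  with Suc newton_space_SucI[of u "f * g" "f * q" N] show ?case
    by (simp only: free_of_intros distrib_left mult.assoc)
qed simp

lemma newton_space_Var:
  "p \<in> newton_space u N \<Longrightarrow> Var u * p \<in> newton_space u (Suc N)"
proof (induction N arbitrary: p)
  case 0
  then show ?case using newton_space_zero[of u "Suc 0"] by (simp del: newton_space.simps(2))
next
  case (Suc N)
  then obtain f q where f: "free_of u f" and q: "q \<in> newton_space u N"
    and p: "p = f * pochhammer (Var u) N + q" by auto
  have "(Const (- of_nat N) * f) * pochhammer (Var u) N + 0 \<in> newton_space u (Suc N)"
    by (intro newton_space_SucI free_of_intros f newton_space_zero)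
  from newton_space_add[OF this Suc.IH[OF q]]
  \<comment> \<open>With \<open>X\<^sub>N\<close> the rising factorial of length \<open>N\<close>: \<open>X * X\<^sub>N = X\<^sub>N\<^sub>+\<^sub>1 - N * X\<^sub>N\<close>.\<close>
  have "f * pochhammer (Var u) (Suc N) + ((Const (- of_nat N) * f) * pochhammer (Var u) N + 0 + Var u * q)
      \<in> newton_space u (Suc (Suc N))"
    by (rule newton_space_SucI[OF f])
  also have "f * pochhammer (Var u) (Suc N) + ((Const (- of_nat N) * f) * pochhammer (Var u) N + 0 + Var u * q)
      = Var u * p"
    by (simp add: p pochhammer_Suc Const_of_nat algebra_simps)
  finally show ?case .
qed

lemma newton_expansion: "\<exists>N. p \<in> newton_space u N"
proof (induction p rule: mpoly_induct)
  case (const c)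
  have "Const c * pochhammer (Var u) 0 + 0 \<in> newton_space u (Suc 0)"
    by (intro newton_space_SucI free_of_intros newton_space_zero)
  then show ?case by (simp only: pochhammer_0 mult_1_right add_0_right) blast
next
  case (add p q)
  then obtain N M where "p \<in> newton_space u N" "q \<in> newton_space u M" by blast
  then have "p + q \<in> newton_space u (max N M)"
    by (intro newton_space_add newton_space_mono[of N "max N M"] newton_space_mono[of M "max N M"]) auto
  then show ?case by blast
next
  case (var v p)
  then obtain N where N: "p \<in> newton_space u N" by blast
  show ?case
  proof (cases "v = u")
    case True
    then show ?thesis using newton_space_Var[OF N] by blast
  next
    case False
    then show ?thesis using newton_space_mult[OF free_of_intros(3) N] by blast
  qed
qed

lemma backward_diff_newton_space:
  "p \<in> newton_space u (Suc N) \<Longrightarrow> backward_diff u p \<in> newton_space u N"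
proof (induction N arbitrary: p)
  case 0
  then obtain f where "free_of u f" "p = f" by auto
  then have "backward_diff u p = f * backward_diff u 1"
    using backward_diff_mult[of u f 1] by simp
  moreover have "backward_diff u 1 = 0"
    using shift_hom(3)[of _ 1] by (simp add: backward_diff_def)
  ultimately show ?case by simp
next
  case (Suc N)
  from Suc.prems obtain f q where f: "free_of u f" and q: "q \<in> newton_space u (Suc N)"
    and p: "p = f * pochhammer (Var u) (Suc N) + q"
    by (auto simp del: newton_space.simps simp: newton_space.simps(2)[of u "Suc N"])
  have "(f * Const (- of_nat (Suc N))) * pochhammer (Var u) N + backward_diff u q \<in> newton_space u (Suc N)"
    by (intro newton_space_SucI free_of_intros f Suc.IH q)
  also have "(f * Const (- of_nat (Suc N))) * pochhammer (Var u) N + backward_diff u q = backward_diff u p"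
    unfolding p backward_diff_add backward_diff_mult[OF f] backward_diff_pochhammer
    by (simp only: mult.assoc)
  finally show ?case .
qed

lemma backward_diff_funpow_newton_space:
  "p \<in> newton_space u N \<Longrightarrow> (backward_diff u ^^ N) p = 0"
proof (induction N arbitrary: p)
  case (Suc N)
  from Suc.IH[OF backward_diff_newton_space[OF Suc.prems]] show ?case
    by (simp only: funpow_Suc_right o_apply)
qed simp

text \<open>The constant is \<open>(-1)\<^sup>N N!\<close>, nonzero in characteristic \<open>0\<close>.\<close>

lemma backward_diff_funpow_pochhammer:
  "\<exists>c. c \<noteq> 0 \<and> (\<forall>f. free_of u f \<longrightarrow> (backward_diff u ^^ N) (f * pochhammer (Var u) N) = Const c * f)"
proof (induction N)
  case 0
  show ?case by (rule exI[of _ 1]) simp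
next
  case (Suc N)
  then obtain c where c: "c \<noteq> 0"
    "\<And>f. free_of u f \<Longrightarrow> (backward_diff u ^^ N) (f * pochhammer (Var u) N) = Const c * f"
    by blast
  have "(backward_diff u ^^ Suc N) (f * pochhammer (Var u) (Suc N)) = Const (c * - of_nat (Suc N)) * f"
    if f: "free_of u f" for f
  proof -
    have "(backward_diff u ^^ Suc N) (f * pochhammer (Var u) (Suc N))
        = (backward_diff u ^^ N) ((f * Const (- of_nat (Suc N))) * pochhammer (Var u) N)"
      unfolding funpow_Suc_right o_apply backward_diff_mult[OF f] backward_diff_pochhammer
      by (simp only: mult.assoc)
    also have "\<dots> = Const c * (f * Const (- of_nat (Suc N)))"
      by (intro c(2) free_of_intros f)
    finally show ?thesis by (simp only: Const_mult mult.assoc mult.left_commute mult.commute)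
  qed
  moreover have "c * - of_nat (Suc N) \<noteq> 0" using c(1) by (simp del: of_nat_Suc)
  ultimately show ?case by blast
qed

lemma Const_mult_eq_0: "c \<noteq> 0 \<Longrightarrow> Const c * p = 0 \<Longrightarrow> p = (0 :: 'v mpoly)"
proof -
  assume "c \<noteq> 0" and "Const c * p = 0"
  then have "Const (inverse c * c) * p = 0"
    by (simp only: Const_mult mult.assoc mult_zero_right)
  with \<open>c \<noteq> 0\<close> show "p = 0" by simp
qed

text \<open>If \<open>p\<close> has degree \<open>k\<close> in \<open>u\<close>, then \<open>k\<close> differences kill the lower terms and turn the leading
  term into a nonzero multiple of its coefficient.\<close>

lemma backward_diff_eliminates:
  assumes "p \<noteq> 0"
  obtains k where "(backward_diff u ^^ k) p \<noteq> 0" "free_of u ((backward_diff u ^^ k) p)"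
proof -
  have "\<exists>k. (backward_diff u ^^ k) p \<noteq> 0 \<and> free_of u ((backward_diff u ^^ k) p)"
    if "p \<in> newton_space u N" for N
    using that
  proof (induction N)
    case 0
    with assms show ?case by simp
  next
    case (Suc N)
    then obtain f q where f: "free_of u f" and q: "q \<in> newton_space u N"
      and p: "p = f * pochhammer (Var u) N + q" by auto
    show ?case
    proof (cases "f = 0")
      case True
      with p q Suc.IH show ?thesis by simp
    next
      case False
      obtain c where c: "c \<noteq> 0" "(backward_diff u ^^ N) (f * pochhammer (Var u) N) = Const c * f"
        using backward_diff_funpow_pochhammer[of u N] f by blast
      then have "(backward_diff u ^^ N) p = Const c * f"
        by (simp add: p backward_diff_funpow_add backward_diff_funpow_newton_space[OF q])
      moreover have "Const c * f \<noteq> 0" using Const_mult_eq_0[OF c(1)] False by blast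
      moreover have "free_of u (Const c * f)" using f by (intro free_of_intros)
      ultimately show ?thesis by metis
    qed
  qed
  with newton_expansion[of p u] that show ?thesis by blast
qed

text \<open>Setting the variables \<open>d\<^sub>j\<close> to \<open>0\<close> one at a time does not change \<open>p\<close>, so setting all of them to
  \<open>0\<close> does not either, and the result of that lies in the image of \<open>U(\<hh>)\<close>.\<close>

lemma free_of_all_Inr:
  fixes p :: "('i + 'n::finite) mpoly"
  assumes "\<And>j. free_of (Inr j) p"
  obtains f where "p = embed_h f"
proof -
  have "subst (\<lambda>v. if v \<in> Inr ` J then 0 else Var v) p = p" if "finite J" for J :: "'n set"
    using that
  proof (induction J)
    case (insert j J)
    have "subst (\<lambda>v. if v \<in> Inr ` insert j J then 0 else Var v) p
        = subst (\<lambda>v. if v \<in> Inr ` J then 0 else Var v) (subst (Var(Inr j := 0)) p)"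
      unfolding subst_subst by (rule arg_cong[where f = "\<lambda>f. subst f p"]) (auto simp: fun_eq_iff)
    then show ?case using insert.IH assms by (simp add: free_of_def)
  qed simp
  from this[OF finite_class.finite_UNIV]
  have "p = subst (\<lambda>v. if v \<in> range Inr then 0 else Var v) p"
    by (rule sym)
  also have "\<dots> = embed_h (subst (case_sum Var (\<lambda>_. 0)) p)"
    unfolding embed_h_def subst_subst
    by (rule arg_cong[where f = "\<lambda>f. subst f p"]) (auto simp: fun_eq_iff split: sum.split)
  finally show ?thesis using that by blast
qed

text \<open>Multiplication by a variable only translates the exponents.\<close>

lemma Var_mult_eq_0:
  assumes "Var v * p = 0"
  shows "p = 0"
proof -
  have "Poly_Mapping.lookup (Var v * q) (Poly_Mapping.single v 1 + m) = Poly_Mapping.lookup q m" for q m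
  proof (induction q rule: poly_mapping_additive_induct)
    case (single k c)
    show ?case by (auto simp: Var_def mult_single lookup_single when_def)
  qed (simp_all add: distrib_left lookup_add)
  from this[of p] assms show ?thesis by (simp add: poly_mapping_eq_iff fun_eq_iff)
qed

lemma Var_power_mult_eq_0: "Var v ^ k * p = 0 \<Longrightarrow> p = 0"
  by (induction k) (auto simp: mult.assoc dest: Var_mult_eq_0)

section \<open>Evaluation of the degree variables at zero\<close>

definition eval_d :: "('i + 'n) mpoly \<Rightarrow> 'i mpoly" where
  "eval_d = subst (case_sum Var (\<lambda>_. 0))"

lemma eval_d_embed_h: "eval_d (embed_h f) = f"
  by (simp add: eval_d_def embed_h_def subst_subst)

lemma eval_d_embed_d: "\<exists>c. eval_d (embed_d q) = Const c"
proof (induction q rule: mpoly_induct)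
  case (add p q)
  then show ?case by (metis Const_simps(3) embed_d_hom(1) eval_d_def subst_add)
next
  case (var v p)
  show ?case by (rule exI[of _ 0]) (simp add: eval_d_def embed_d_hom subst_mult)
qed (auto simp: eval_d_def embed_d_hom)

section \<open>Simplicity of the two modules\<close>

text \<open>This is \<open>W \<otimes> U(D)\<close> inside \<open>U(\<hh>) \<otimes> U(D)\<close>.\<close>

definition induced_submodule :: "'i mpoly set \<Rightarrow> ('i + 'n) mpoly set" where
  "induced_submodule W = poly.span {embed_h f * embed_d q | f q. f \<in> W}"

lemma induced_submodule_subspace: "poly.subspace (induced_submodule W)"
  unfolding induced_submodule_def by (rule poly.subspace_span)

context
  fixes scaleG :: "complex \<Rightarrow> 'g::ab_group_add \<Rightarrow> 'g" and bracket :: "'g \<Rightarrow> 'g \<Rightarrow> 'g"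
    and act :: "'g \<Rightarrow> 'i::finite mpoly \<Rightarrow> 'i mpoly" and lam :: "complex ^ 'n::finite"
  assumes simple_g: "simple_lie_algebra scaleG bracket"
    and module_g: "lie_module scaleG bracket poly_scale act"
    and lam: "\<forall>j. lam $ j \<noteq> 0"
begin

interpretation simple_lie_algebra scaleG bracket by (rule simple_g)
interpretation M: lie_module scaleG bracket poly_scale act by (rule module_g)
interpretation T: lie_module "toroidal_scale scaleG" tbracket poly_scale
    "toroidal_act lam act :: ('g, 'n) toroidal \<Rightarrow> _"
  by (rule TA_module[OF simple_g module_g lam])

lemma lambda_power_nonzero: "lambda_power lam a \<noteq> 0"
  using lam by (simp add: lambda_power_def)

text \<open>On a pure tensor \<open>x(a)\<close> applies \<open>x\<close> to the left factor and shifts the right one, while the degree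
  derivations multiply the right factor only.\<close>

lemma TA_induced_submodule:
  assumes W: "M.submodule W" and g: "g \<in> induced_submodule W"
  shows "toroidal_act lam act u g \<in> induced_submodule W"
proof -
  note ss = induced_submodule_subspace[of W]
  have gen: "embed_h f * embed_d q \<in> induced_submodule W" if "f \<in> W" for f and q :: "'n mpoly"
    unfolding induced_submodule_def by (rule poly.span_base) (use that in blast)
  have pure: "toroidal_act lam act u (embed_h f * embed_d q) \<in> induced_submodule W"
    if f: "f \<in> W" for u :: "('g, 'n) toroidal" and f q
  proof (induction u rule: toroidal_induct)
    case (add u v)
    then show ?case by (simp add: TA_add_left[OF simple_g module_g lam] poly.subspace_add[OF ss])
  next
    case (loop a x)
    have "act x f \<in> W" using W f by (simp add: M.submodule_def)
    then have "poly_scale (lambda_power lam a) (embed_h (act x f) * embed_d (shift (\<lambda>j. of_int (a $ j)) q))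
        \<in> induced_submodule W"
      by (intro poly.subspace_scale[OF ss] gen)
    then show ?case
      by (simp add: TA_loop[OF simple_g module_g lam] tau_hom tau_embed tau_embed_d
          tensor_id_pure[OF M.act_linear_right] poly_scale_def)
  next
    case (central k)
    show ?case by (simp add: TA_central[OF simple_g module_g lam] poly.subspace_0[OF ss])
  next
    case (degree \<delta>)
    show ?case
      using gen[OF f, of "deg_poly \<delta> * q"]
      by (simp add: TA_degree[OF simple_g module_g lam] embed_d_hom mult.left_commute)
  qed
  from g have "g \<in> poly.span {embed_h f * embed_d q | f q. f \<in> W}"
    by (simp add: induced_submodule_def)
  then show ?thesis
  proof (induction rule: poly.span_induct_alt)
    case base
    show ?case
      using TA_right(2)[OF simple_g module_g lam, of u 0 0] poly.subspace_0[OF ss] by simp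
  next
    case (step c p q)
    then have "toroidal_act lam act u p \<in> induced_submodule W"
      using pure by blast
    with step show ?case
      by (simp add: poly_scale_def[of c p] TA_right[OF simple_g module_g lam] poly.subspace_add[OF ss]
          poly.subspace_scale[OF ss] flip: poly_scale_def[of c "toroidal_act lam act u p"])
  qed
qed

text \<open>Evaluation at \<open>d = 0\<close> turns the right factor of a pure tensor into a scalar. This recovers \<open>W\<close>
  from \<open>W \<otimes> U(D)\<close>, so the latter is proper if \<open>W\<close> is.\<close>

lemma eval_d_induced_submodule:
  assumes W: "M.submodule W" and g: "(g :: ('i + 'n) mpoly) \<in> induced_submodule W"
  shows "eval_d g \<in> W"
proof -
  have ss: "poly.subspace W" using W by (simp add: M.submodule_def)
  from g have "g \<in> poly.span {embed_h f * embed_d q | f q. f \<in> W}"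
    by (simp add: induced_submodule_def)
  then show ?thesis
  proof (induction rule: poly.span_induct_alt)
    case base
    show ?case by (simp add: eval_d_def poly.subspace_0[OF ss])
  next
    case (step c p q)
    then obtain f r where fr: "f \<in> W" "p = embed_h f * embed_d r" by blast
    obtain b where b: "eval_d (embed_d r :: ('i + 'n) mpoly) = Const b" using eval_d_embed_d by blast
    have "eval_d p = f * Const b"
      unfolding fr(2) by (metis b eval_d_def eval_d_embed_h subst_mult)
    then have "eval_d (poly_scale c p + q) = poly_scale c (poly_scale b f) + eval_d q"
      by (simp add: eval_d_def poly_scale_def subst_add subst_mult mult.commute)
    with step fr(1) show ?case
      by (simp add: poly.subspace_add[OF ss] poly.subspace_scale[OF ss])
  qed
qed

lemma simple_if_toroidal_simple:
  assumes "simple_lie_module (toroidal_scale scaleG) tbracket poly_scale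
    (toroidal_act lam act :: ('g, 'n) toroidal \<Rightarrow> _)"
  shows "simple_lie_module scaleG bracket poly_scale act"
proof
  interpret S: simple_lie_module "toroidal_scale scaleG" tbracket poly_scale
    "toroidal_act lam act :: ('g, 'n) toroidal \<Rightarrow> _" by fact
  have "(1 :: 'i mpoly) \<noteq> 0" by simp
  then show "\<exists>v :: 'i mpoly. v \<noteq> 0" by blast
  fix W assume W: "M.submodule W"
  let ?I = "induced_submodule W :: ('i + 'n) mpoly set"
  have "T.submodule ?I"
    unfolding T.submodule_def
    using induced_submodule_subspace[of W] TA_induced_submodule[OF W] by blast
  then consider "?I = {0}" | "?I = UNIV" using S.simple by blast
  then show "W = {0} \<or> W = UNIV"
  proof cases
    case 1
    have "f = 0" if "f \<in> W" for f
    proof -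
      have "embed_h f * embed_d 1 \<in> ?I"
        unfolding induced_submodule_def by (rule poly.span_base) (use that in blast)
      with 1 have "(embed_h f :: ('i + 'n) mpoly) = 0" by simp
      then show ?thesis using eval_d_embed_h[of f] by (metis eval_d_def subst_zero)
    qed
    moreover have "0 \<in> W" using W by (simp add: M.submodule_def poly.subspace_0)
    ultimately show ?thesis by blast
  next
    case 2
    have "f \<in> W" for f
      using eval_d_induced_submodule[OF W, of "embed_h f"] 2 by (simp add: eval_d_embed_h)
    then show ?thesis by blast
  qed
qed

text \<open>The element \<open>z\<close> is some basis vector \<open>H\<^sub>i\<close> of the Cartan subalgebra. Since it acts by an
  injective multiplication, \<open>z(a)\<close> gives access to the shifts \<open>\<tau>\<^sup>a\<close>, and their differences lower
  the degree in the \<open>d\<^sub>j\<close>.\<close>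

lemma toroidal_simple_if_simple:
  assumes simple: "simple_lie_module scaleG bracket poly_scale act"
    and H: "\<And>f. act z f = Var i * f"
  shows "simple_lie_module (toroidal_scale scaleG) tbracket poly_scale
    (toroidal_act lam act :: ('g, 'n) toroidal \<Rightarrow> _)"
proof
  interpret S: simple_lie_module scaleG bracket poly_scale act by fact
  have "(1 :: ('i + 'n) mpoly) \<noteq> 0" by simp
  then show "\<exists>v :: ('i + 'n) mpoly. v \<noteq> 0" by blast
  fix W assume W: "T.submodule W"
  then have ss: "poly.subspace W" and TW: "\<And>u g. g \<in> W \<Longrightarrow> toroidal_act lam act u g \<in> W"
    unfolding T.submodule_def by blast+
  let ?X = "Var (Inl i) :: ('i + 'n) mpoly"
  have Xtau: "?X * tau a g \<in> W" if "g \<in> W" for a g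
  proof -
    have "tensor_id (act z) g = ?X * g" for g :: "('i + 'n) mpoly"
    proof (induction g rule: mpoly_tensor_induct)
      case (pure f q)
      show ?case
        by (simp only: tensor_id_pure[OF M.act_linear_right]) (simp add: H embed_h_hom mult.assoc)
    qed (simp add: tensor_id_add distrib_left)
    then have "toroidal_act lam act (loop_elt a z) g = poly_scale (lambda_power lam a) (?X * tau a g)"
      by (simp add: TA_loop[OF simple_g module_g lam] poly_scale_def)
    with TW[OF that, of "loop_elt a z"]
    have "poly_scale (lambda_power lam a) (?X * tau a g) \<in> W" by simp
    from poly.subspace_scale[OF ss this, of "inverse (lambda_power lam a)"]
    show ?thesis by (simp add: lambda_power_nonzero)
  qed
  \<comment> \<open>Differences of \<open>W\<close> lie in \<open>W\<close> only up to a factor \<open>H\<^sub>i\<close>, so they are taken in the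
    saturation of \<open>W\<close> with respect to \<open>H\<^sub>i\<close>.\<close>
  define S where "S = {g. \<exists>k. ?X ^ k * g \<in> W}"
  have diff_S: "backward_diff (Inr j) g \<in> S" if "g \<in> S" for g j
  proof -
    from that obtain k where k: "?X ^ k * g \<in> W" by (auto simp: S_def)
    have free: "free_of (Inr j) (?X ^ m)" for m
      by (induction m) (use free_of_intros(1)[of "Inr j" 1] in \<open>auto intro: free_of_intros\<close>)
    have "?X * tau (axis j 1) (?X ^ k * g) - ?X * tau 0 (?X ^ k * g) \<in> W"
      by (intro poly.subspace_diff[OF ss] Xtau k)
    also have "?X * tau (axis j 1) (?X ^ k * g) - ?X * tau 0 (?X ^ k * g)
        = ?X * backward_diff (Inr j) (?X ^ k * g)"
      by (simp add: tau_axis backward_diff_def right_diff_distrib)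
    also have "\<dots> = ?X ^ Suc k * backward_diff (Inr j) g"
      by (simp add: backward_diff_mult[OF free] mult.assoc)
    finally show ?thesis unfolding S_def by blast
  qed
  then have diffs_S: "(backward_diff (Inr j) ^^ k) g \<in> S" if "g \<in> S" for g j k
    by (induction k) (simp_all add: that)
  show "W = {0} \<or> W = UNIV"
  proof (rule disjCI)
    assume "W \<noteq> UNIV"
    have "W \<subseteq> {0}"
    proof (rule ccontr)
      assume "\<not> W \<subseteq> {0}"
      then obtain g where g: "g \<in> W" "g \<noteq> 0" by blast
      have "\<exists>p\<in>S. p \<noteq> 0 \<and> (\<forall>j\<in>J. free_of (Inr j) p)" if "finite J" for J
        using that
      proof (induction J)
        case empty
        have "?X ^ 0 * g \<in> W" using g by simp
        then have "g \<in> S" unfolding S_def by blast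
        with g(2) show ?case by blast
      next
        case (insert j J)
        then obtain p where p: "p \<in> S" "p \<noteq> 0" "\<forall>j\<in>J. free_of (Inr j) p" by blast
        obtain k where k: "(backward_diff (Inr j) ^^ k) p \<noteq> 0" "free_of (Inr j) ((backward_diff (Inr j) ^^ k) p)"
          using p(2) by (rule backward_diff_eliminates)
        have "free_of (Inr j') ((backward_diff (Inr j) ^^ k) p)" if "j' \<in> J" for j'
        proof -
          from that insert.hyps have "Inr j' \<noteq> (Inr j :: 'i + 'n)" by auto
          then show ?thesis by (induction k) (simp_all add: free_of_backward_diff p(3) that)
        qed
        with k diffs_S[OF p(1)] show ?case by blast
      qed
      from this[of UNIV] obtain p where p: "p \<in> S" "p \<noteq> 0" "\<And>j. free_of (Inr j) p" by auto
      obtain f where f: "p = embed_h f" using p(3) by (rule free_of_all_Inr)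
      from p(1) obtain k where k: "?X ^ k * p \<in> W" by (auto simp: S_def)
      have embed_power: "embed_h (Var i ^ k * f) = ?X ^ k * (embed_h f :: ('i + 'n) mpoly)"
        by (induction k) (simp_all add: embed_h_hom mult.assoc)
      \<comment> \<open>The loop elements of degree \<open>0\<close> form a copy of \<open>\<gg>\<close> acting on the left factor only.\<close>
      define W0 where "W0 = {f. (embed_h f :: ('i + 'n) mpoly) \<in> W}"
      have "M.submodule W0"
        unfolding M.submodule_def
      proof (intro conjI allI ballI poly.subspaceI)
        show "0 \<in> W0" by (simp add: W0_def poly.subspace_0[OF ss])
        show "p + q \<in> W0" if "p \<in> W0" "q \<in> W0" for p q
          using that by (simp add: W0_def embed_h_hom poly.subspace_add[OF ss])
        show "poly_scale c p \<in> W0" if "p \<in> W0" for c p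
          using poly.subspace_scale[OF ss, of "embed_h p" c] that
          by (simp add: W0_def poly_scale_def embed_h_hom)
        show "act x f \<in> W0" if "f \<in> W0" for x f
        proof -
          have "toroidal_act lam act (loop_elt 0 x) (embed_h f) \<in> W"
            using that by (intro TW) (simp add: W0_def)
          moreover have "toroidal_act lam act (loop_elt (0 :: int ^ 'n) x) (embed_h f) = embed_h (act x f)"
            using tensor_id_pure[OF M.act_linear_right, of x f "1 :: 'n mpoly"]
            by (simp add: TA_loop[OF simple_g module_g lam] lambda_power_def)
          ultimately show ?thesis by (simp add: W0_def)
        qed
      qed
      moreover have "Var i ^ k * f \<in> W0" using k by (simp add: W0_def embed_power f)
      moreover have "Var i ^ k * f \<noteq> 0"
        using p(2) f by (auto dest: Var_power_mult_eq_0)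
      ultimately have "W0 = UNIV" using S.simple by blast
      then have h_W: "embed_h f \<in> W" for f by (auto simp: W0_def)
      have d_W: "embed_d q * g \<in> W" if "g \<in> W" for q g
      proof (induction q rule: mpoly_induct)
        case (const c)
        show ?case using poly.subspace_scale[OF ss that, of c] by (simp add: embed_d_hom poly_scale_def)
      next
        case (add p q)
        then show ?case by (simp add: embed_d_hom distrib_right poly.subspace_add[OF ss])
      next
        case (var j q)
        have "deg_poly (axis j 1) = Var j"
          unfolding deg_poly_def by (subst sum.remove[of _ j]) (auto simp: axis_def)
        then show ?case
          using TW[OF var, of "(0, 0, axis j 1)"]
          by (simp add: TA_degree[OF simple_g module_g lam] embed_d_hom mult.assoc)
      qed
      have "g \<in> W" for g
      proof (induction g rule: mpoly_tensor_induct)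
        case (pure f q)
        show ?case using d_W[OF h_W] by (simp only: mult.commute[of "embed_h f"])
      qed (rule poly.subspace_add[OF ss])
      with \<open>W \<noteq> UNIV\<close> show False by blast
    qed
    then show "W = {0}" using poly.subspace_0[OF ss] by blast
  qed
qed

end

theorem proposition4p1:
  fixes scaleG :: "complex \<Rightarrow> 'g::ab_group_add \<Rightarrow> 'g"
    and bracket :: "'g \<Rightarrow> 'g \<Rightarrow> 'g"
    and \<hh> :: "'g set"
    and x y h H :: "'i::finite \<Rightarrow> 'g"
    and lam :: "complex ^ 'n::finite"
    and act :: "'g \<Rightarrow> 'i mpoly \<Rightarrow> 'i mpoly"
    and actT :: "('g, 'n) toroidal \<Rightarrow> ('i + 'n) mpoly \<Rightarrow> ('i + 'n) mpoly"
  assumes "simple_lie_algebra scaleG bracket"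
    and "lie_algebra.cartan_subalgebra scaleG bracket \<hh>"
    and "lie_algebra.chevalley_generators scaleG bracket \<hh> x y h"
    and "lie_algebra.root_dual_basis scaleG bracket \<hh> x y H"
    and "\<forall>j. lam $ j \<noteq> 0"
    and "free_rank_one_object scaleG bracket H act"
    and "toroidal_module scaleG bracket x y H lam act actT"
  shows "simple_lie_module (toroidal_scale scaleG) (toroidal_bracket scaleG bracket) poly_scale actT
    \<longleftrightarrow> simple_lie_module scaleG bracket poly_scale act"
proof -
  interpret simple_lie_algebra scaleG bracket by fact
  note obj = assms(6)
  have module: "lie_module scaleG bracket poly_scale act"
    using obj by (simp add: free_rank_one_object_def)
  have actT: "actT = toroidal_act lam act"
    using toroidal_module_unique[OF assms(3,7) toroidal_module_exists[OF assms(4-6)]] .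
  have H: "act (H i) f = Var i * f" for i f
  proof -
    have "(\<Sum>k\<in>UNIV. scaleG (if k = i then 1 else 0) (H k)) = H i"
      by (subst sum.remove[of _ i]) auto
    moreover have "(\<Sum>k\<in>UNIV. Const (if k = i then 1 else 0) * Var k) = Var i"
      by (subst sum.remove[of _ i]) auto
    ultimately show ?thesis using obj unfolding free_rank_one_object_def by metis
  qed
  show ?thesis
    unfolding actT
    using simple_if_toroidal_simple[OF assms(1) module assms(5)]
      toroidal_simple_if_simple[OF assms(1) module assms(5) _ H] by blast
qed

end
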